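(* Let $n$ be a positive integer coprime with $3$. Then \[ \sum_{k=0}^{n-1} [6k+1]\frac{(q;q^3)_k^6}{(q^3;q^3)_k^6}\, q^{3k} \equiv \begin{cases} 0 \pmod{[n]}, &\text{if } n\equiv 1\pmod 3,\\ 0 \pmod{[n]\Phi_n(q)}, &\text{if } n\equiv 2\pmod 3. \end{cases} \]
   Context: Here $q$ is an indeterminate. For $x$ and a base $p$ (a power of $q$), $(x;p)_k=\prod_{j=0}^{k-1}(1-xp^j)$ for integers $k\ge 0$. The $q$-integer is $[m]=1+q+\cdots+q^{m-1}$, and $\Phi_n(q)$ is the $n$-th cyclotomic polynomial. For rational functions $A(q),B(q)$ and a polynomial $P(q)$, $A(q)\equiv B(q)\pmod{P(q)}$ means that the numerator of the reduced form of $A(q)-B(q)$ is divisible by $P(q)$ in $\mathbb{Z}[q]$. *)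

theory Defs
  imports Complex_Main "HOL-Computational_Algebra.Computational_Algebra" "HOL-Number_Theory.Cong"
begin

text \<open>Rational functions in the indeterminate \<open>q\<close> are elements of the fraction field of
  \<open>\<int>[q]\<close>, which is the same field as \<open>\<rat>(q)\<close>.\<close>

definition qvar :: "int poly fract" where
  "qvar = to_fract [:0, 1:]"

definition q_pochhammer :: "'a :: comm_ring_1 \<Rightarrow> 'a \<Rightarrow> nat \<Rightarrow> 'a" where
  "q_pochhammer x p k = (\<Prod>j<k. 1 - x * p ^ j)"

definition q_int :: "'a :: comm_semiring_1 \<Rightarrow> nat \<Rightarrow> 'a" where
  "q_int q m = (\<Sum>i<m. q ^ i)"

text \<open>The unique polynomial in \<open>\<int>[q]\<close> whose image in \<open>\<complex>[q]\<close> is the product of \<open>q - \<zeta>\<close> over the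
  primitive \<open>n\<close>-th roots of unity \<open>\<zeta>\<close>; for \<open>n > 0\<close> it exists by \<open>cyclotomic_poly_of_int\<close> below.\<close>

definition cyclotomic_poly :: "nat \<Rightarrow> int poly" where
  "cyclotomic_poly n = (THE P. map_poly (of_int :: int \<Rightarrow> complex) P =
     (\<Prod>k | k \<in> {1..n} \<and> coprime k n. [:- cis (2 * pi * real k / real n), 1:]))"

text \<open>\<^const>\<open>quot_of_fract\<close> returns the numerator and denominator of the reduced form over \<open>\<int>[q]\<close>, so
  the divisibility below is divisibility in \<open>\<int>[q]\<close>.\<close>

definition ratfun_cong :: "int poly fract \<Rightarrow> int poly fract \<Rightarrow> int poly \<Rightarrow> bool" where
  "ratfun_cong A B P \<longleftrightarrow> P dvd fst (quot_of_fract (A - B))"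

context
begin

private definition C :: "nat \<Rightarrow> complex poly" where
  "C n = (\<Prod>k | k \<in> {1..n} \<and> coprime k n. [:- cis (2 * pi * real k / real n), 1:])"

private abbreviation "ic \<equiv> map_poly (of_int :: int \<Rightarrow> complex)"

private lemma ic_add: "ic (p + q) = ic p + ic q"
  by (rule poly_eqI) (simp add: coeff_map_poly)

private lemma ic_mult: "ic (p * q) = ic p * ic q"
  by (rule poly_eqI) (simp add: coeff_map_poly coeff_mult)

private lemma ic_prod: "finite A \<Longrightarrow> ic (prod f A) = (\<Prod>x\<in>A. ic (f x))"
  by (induction A rule: finite_induct) (auto simp: ic_mult map_poly_1)

private lemma ic_inj: "ic p = ic q \<Longrightarrow> p = q"
  by (metis coeff_map_poly of_int_0 of_int_eq_iff poly_eqI)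

private lemma ic_degree: "degree (ic p) = degree p"
  by (rule degree_map_poly) auto

private lemma C_monic: "lead_coeff (C n) = 1"
  by (simp add: C_def lead_coeff_prod)

private lemma prod_C:
  assumes n: "n > 0"
  shows "monom 1 n - 1 = (\<Prod>d | d dvd n. C d)"
proof -
  let ?z = "\<lambda>k::nat. cis (2 * pi * real k / real n)"
  let ?R = "\<Prod>k\<in>{1..n}. [:- ?z k, 1:]"
  let ?S = "SIGMA d:{d. d dvd n}. {k. k \<in> {1..d} \<and> coprime k d}"
  have bij: "bij_betw ?z {..<n} {z. z ^ n = 1}"
    by (rule Complex.bij_betw_roots_unity[OF n])
  have fin: "finite {d. d dvd n}" using n by simp
  have root0: "?z 0 = ?z n" using n by simp
  have set_eq: "{1..n} = insert n ({..<n} - {0})" using n by auto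
  have "?R = (\<Prod>k<n. [:- ?z k, 1:])"
  proof -
    have "?R = [:- ?z n, 1:] * (\<Prod>k\<in>{..<n} - {0}. [:- ?z k, 1:])"
      unfolding set_eq by (subst prod.insert) auto
    also have "\<dots> = (\<Prod>k<n. [:- ?z k, 1:])"
      using n by (subst root0[symmetric], subst prod.remove[of "{..<n}" 0]) auto
    finally show ?thesis .
  qed
  also have "\<dots> = (\<Prod>z | z ^ n = 1. [:- z, 1:])"
    by (rule prod.reindex_bij_betw[OF bij])
  also have "\<dots> = monom 1 n - 1"
  proof (rule ccontr)
    let ?P = "\<Prod>z::complex | z ^ n = 1. [:- z, 1:]"
    let ?D = "?P - (monom 1 n - 1)"
    assume ne: "?P \<noteq> monom 1 n - 1"
    have cardn: "card {z::complex. z ^ n = 1} = n"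
      using bij_betw_same_card[OF bij] by simp
    have finr: "finite {z::complex. z ^ n = 1}"
      using bij_betw_finite[OF bij] by simp
    have degP: "degree ?P = n"
      by (subst degree_prod_eq_sum_degree) (auto simp: cardn)
    have cP: "coeff ?P n = 1"
      using lead_coeff_prod[of "\<lambda>z. [:- z, 1:]" "{z::complex. z ^ n = 1}"] degP by simp
    have degD: "degree ?D < n"
    proof (rule degree_lessI)
      show "?D \<noteq> 0 \<or> 0 < n" using n by simp
      show "\<forall>k\<ge>n. coeff ?D k = 0"
      proof (intro allI impI)
        fix k assume "k \<ge> n"
        show "coeff ?D k = 0"
        proof (cases "k = n")
          case True
          then show ?thesis using cP n by simp
        next
          case False
          then have "k > n" using \<open>k \<ge> n\<close> by simp
          then show ?thesis using degP n by (simp add: coeff_eq_0)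
        qed
      qed
    qed
    have "{z. z ^ n = 1} \<subseteq> {x. poly ?D x = 0}"
    proof
      fix z :: complex assume z: "z \<in> {z. z ^ n = 1}"
      then have "poly ?P z = 0"
        using finr by (auto simp: poly_prod)
      then show "z \<in> {x. poly ?D x = 0}" using z by (simp add: poly_monom)
    qed
    moreover have "finite {x. poly ?D x = 0}"
      using ne by (intro poly_roots_finite) (simp only: right_minus_eq not_False_eq_True)
    ultimately have "card {z::complex. z ^ n = 1} \<le> card {x. poly ?D x = 0}"
      by (rule card_mono[rotated])
    then have "n \<le> card {x. poly ?D x = 0}"
      by (simp only: cardn)
    also have "\<dots> \<le> degree ?D" using ne by (intro card_poly_roots_bound) auto
    finally show False using degD by simp
  qed
  finally have 1: "?R = monom 1 n - 1" .
  have "?R = (\<Prod>(d, k)\<in>?S. [:- cis (2 * pi * real k / real d), 1:])"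
  proof (rule prod.reindex_bij_witness[where
        j = "\<lambda>k. (n div gcd k n, k div gcd k n)" and i = "\<lambda>(d, k). k * (n div d)"])
    fix k assume k: "k \<in> {1..n}"
    show "(case (n div gcd k n, k div gcd k n) of (d, k) \<Rightarrow> k * (n div d)) = k"
    proof -
      have "n div (n div gcd k n) = gcd k n"
        using n dvd_div_eq_mult[of "gcd k n" n]
        by (metis div_mult_self_is_m dvd_div_mult_self gcd_dvd2 gr0I mult_0 mult.commute)
      then show ?thesis by simp
    qed
    have "gcd k n \<le> k" using k by (intro gcd_le1_nat) auto
    then have "k div gcd k n \<ge> 1" using n by (simp add: div_greater_zero_iff Suc_le_eq)
    moreover have "k div gcd k n \<le> n div gcd k n" using k by (intro div_le_mono) auto
    moreover have "coprime (k div gcd k n) (n div gcd k n)"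
      using n by (intro div_gcd_coprime) auto
    moreover have "n div gcd k n dvd n" by (metis dvd_div_mult_self dvd_triv_left gcd_dvd2)
    ultimately show "(n div gcd k n, k div gcd k n) \<in> ?S" by simp
    have g: "gcd k n > 0" using n by simp
    have "real (k div gcd k n) / real (n div gcd k n) = real k / real n"
      using g by (simp add: real_of_nat_div)
    then have "2 * pi * real (k div gcd k n) / real (n div gcd k n) = 2 * pi * real k / real n"
      by (metis times_divide_eq_right)
    then show "(case (n div gcd k n, k div gcd k n) of
        (d, k) \<Rightarrow> [:- cis (2 * pi * real k / real d), 1:]) = [:- ?z k, 1:]"
      by simp
  next
    fix b assume "b \<in> ?S"
    then obtain d k where b: "b = (d, k)" "d dvd n" "1 \<le> k" "k \<le> d" "coprime k d" by auto
    from b(2) obtain e where e: "n = d * e" by auto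
    have de: "d > 0" "e > 0" using e n by auto
    have nd: "n div d = e" using e de by simp
    have g: "gcd (k * e) (d * e) = e" using b(5) by (simp add: gcd_mult_right gcd.commute[of d k])
    show "(\<lambda>k. (n div gcd k n, k div gcd k n)) (case b of (d, k) \<Rightarrow> k * (n div d)) = b"
      using b(1) nd de g by (simp add: e)
    show "(case b of (d, k) \<Rightarrow> k * (n div d)) \<in> {1..n}"
      using b de nd by (simp add: e)
  qed
  also have "\<dots> = (\<Prod>d | d dvd n. C d)"
    unfolding C_def using fin by (subst prod.Sigma[symmetric]) auto
  finally show ?thesis using 1 by simp
qed

private lemma C_int: "n > 0 \<Longrightarrow> \<exists>P. ic P = C n"
proof (induction n rule: less_induct)
  case (less n)
  let ?A = "{d. d dvd n} - {n}"
  have fin: "finite ?A" using less.prems by simp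
  have "\<exists>P. ic P = C d" if "d \<in> ?A" for d
  proof (rule less.IH)
    show "d < n" using that dvd_imp_le[of d n] less.prems by auto
    show "d > 0" using that less.prems by (auto intro: dvd_pos_nat)
  qed
  then obtain P where P: "\<And>d. d \<in> ?A \<Longrightarrow> ic (P d) = C d" by metis
  define Q where "Q = (\<Prod>d\<in>?A. P d)"
  have icQ: "ic Q = (\<Prod>d\<in>?A. C d)" unfolding Q_def using P fin by (simp add: ic_prod)
  have "lead_coeff (ic Q) = 1" unfolding icQ by (simp add: lead_coeff_prod C_monic)
  then have monic: "lead_coeff Q = 1" by (simp add: ic_degree coeff_map_poly)
  then have Q0: "Q \<noteq> 0" by auto
  define F :: "int poly" where "F = monom 1 n - 1"
  have icF: "ic F = monom 1 n - 1"
    unfolding F_def by (rule poly_eqI) (simp add: coeff_map_poly)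
  obtain s r where sr: "pseudo_divmod F Q = (s, r)" by (cases "pseudo_divmod F Q")
  from pseudo_divmod[OF Q0 sr] monic have F: "F = Q * s + r"
    and r: "r = 0 \<or> degree r < degree Q" by auto
  have "ic F = C n * ic Q"
    unfolding icF icQ prod_C[OF less.prems]
    using less.prems by (subst prod.remove[of _ n]) auto
  then have eq: "ic Q * (C n - ic s) = ic r" using F
    by (simp add: ic_add ic_mult algebra_simps)
  have "C n - ic s = 0"
  proof (rule ccontr)
    assume ne: "C n - ic s \<noteq> 0"
    have Q0': "ic Q \<noteq> 0" using Q0 ic_inj[of Q 0] by auto
    have "degree (ic r) = degree (ic Q) + degree (C n - ic s)"
      unfolding eq[symmetric] using ne Q0' by (rule degree_mult_eq[rotated])
    moreover have "ic r \<noteq> 0" unfolding eq[symmetric] using ne Q0' by simp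
    then have "r \<noteq> 0" by auto
    ultimately show False using r by (simp add: ic_degree)
  qed
  then show ?case by auto
qed

lemma cyclotomic_poly_of_int:
  assumes "n > 0"
  shows "map_poly (of_int :: int \<Rightarrow> complex) (cyclotomic_poly n) =
     (\<Prod>k | k \<in> {1..n} \<and> coprime k n. [:- cis (2 * pi * real k / real n), 1:])"
proof -
  have "\<exists>!P. ic P = C n" using C_int[OF assms] ic_inj by metis
  from theI'[OF this] show ?thesis unfolding cyclotomic_poly_def C_def .
qed

end

end

theory Submission
  imports Defs
begin

text \<open>Let \<open>\<zeta>\<close> be a primitive \<open>d\<close>-th root of unity with \<open>1 < d\<close> and \<open>d dvd n\<close>, and choose \<open>N < d\<close> with
  \<open>d dvd 3 N + 1\<close>. At \<open>q = \<zeta>\<close> the terms with \<open>N < k < d\<close> vanish and the reflection \<open>k \<mapsto> N - k\<close> changes the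
  sign of the others, so the sum over one period is \<open>0\<close>; every further block of \<open>d\<close> terms is a multiple
  of the first one at \<open>\<zeta>\<close>. Hence the sum vanishes at all roots of \<open>[n]\<close>, which are simple.

  If \<open>n = 2\<close> modulo \<open>3\<close> and \<open>d = n\<close>, then \<open>3 N + 1 = 2 n\<close>. Replacing two of the parameters \<open>q\<close> by \<open>q x\<close> and
  \<open>q / x\<close> with \<open>x = q\<^sup>2\<^sup>n\<close> changes the sum only to second order at \<open>\<zeta>\<close>, and turns it into a sum that
  terminates at \<open>N\<close> for every \<open>q\<close> and is evaluated by Jackson's summation. The resulting product
  contains the factor \<open>(1 - q\<^sup>n)\<^sup>3\<close>.\<close>

section \<open>A case of Jackson's summation\<close>

lemma q_pochhammer_0 [simp]: "q_pochhammer x p 0 = 1"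
  by (simp add: q_pochhammer_def)

lemma q_pochhammer_Suc: "q_pochhammer x p (Suc k) = q_pochhammer x p k * (1 - x * p ^ k)"
  by (simp add: q_pochhammer_def)

text \<open>Both sides are \<open>q_pochhammer x p (Suc k)\<close>, split at its first or at its
  last factor.\<close>

lemma q_pochhammer_shift:
  "(1 - x) * q_pochhammer (x * p) p k = q_pochhammer x p k * (1 - x * p ^ k)"
proof -
  have "q_pochhammer x p (Suc k) = (1 - x) * q_pochhammer (x * p) p k"
    unfolding q_pochhammer_def by (subst prod.lessThan_Suc_shift) (simp add: mult.assoc)
  then show ?thesis by (simp add: q_pochhammer_Suc)
qed

lemma q_pochhammer_nonzero:
  fixes x p :: "'a :: idom"
  assumes "\<And>j. j < k \<Longrightarrow> x * p ^ j \<noteq> 1"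
  shows "q_pochhammer x p k \<noteq> 0"
  using assms by (fastforce simp: q_pochhammer_def)

lemma q_int_mult: "(1 - q) * q_int q m = 1 - (q :: 'a :: comm_ring_1) ^ m"
  by (simp add: q_int_def one_diff_power_eq)

text \<open>The terms of Jackson's terminating \<open>\<^sub>8\<phi>\<^sub>7\<close> sum to the base \<open>q\<^sup>3\<close> with \<open>a = b = c = d = q\<close>. The balancing
  condition then forces the remaining parameters to be \<open>e\<close> and \<open>q\<^sup>2 / e\<close>.\<close>

definition jackson_term :: "'a :: field \<Rightarrow> 'a \<Rightarrow> nat \<Rightarrow> 'a" where
  "jackson_term q e k =
     (1 - q ^ (6 * k + 1)) * (q_pochhammer q (q ^ 3) k / q_pochhammer (q ^ 3) (q ^ 3) k) ^ 4 *
     (q_pochhammer e (q ^ 3) k * q_pochhammer (q ^ 2 / e) (q ^ 3) k /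
       (q_pochhammer (q ^ 4 / e) (q ^ 3) k * q_pochhammer (q ^ 2 * e) (q ^ 3) k)) * q ^ (3 * k)"

text \<open>Here \<open>X\<close> stands for \<open>q\<^sup>3\<^sup>k\<close>; this is the telescoping step that relates the sums for \<open>e\<close> and \<open>e q\<^sup>3\<close>.\<close>

lemma jackson_certificate:
  fixes q e X :: "'a :: field"
  assumes "e \<noteq> 0" "q \<noteq> 0"
  shows "X * (1 - q * X^2) * (q^2 * (1 - e)^4 * (1 - X/(e*q)) * (1 - q^2*e*X)
             - (1 - q*e)^4 * (1 - e*X) * (1 - q*X/e))
       + q * e * (1 - q * e^2) * (1 - X)^4 * (1 - q*X/e) * (1 - q^2*e*X)
       = q * e * (1 - q * e^2) * (1 - q*X)^4 * (1 - e*X) * (1 - X/(e*q))"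
  using assms by (simp add: field_simps) algebra

text \<open>The weights \<alpha> and \<beta> make the combination telescope to the closed form
  \<open>?G m\<close>. This contains (q^2/e; q^3)_m, so once that symbol vanishes a two-term
  relation between the sums for \<open>e\<close> and \<open>e * q^3\<close> remains.\<close>

lemma jackson_partial_sum:
  fixes q e :: "'a :: field"
  assumes q: "q \<noteq> 0" "\<And>m. m > 0 \<Longrightarrow> q ^ m \<noteq> 1" and e: "e \<noteq> 0" "e \<noteq> 1"
    and ne: "\<And>m. q * q ^ (3 * m) \<noteq> e" "\<And>m. q ^ m * e \<noteq> 1"
  defines "\<alpha> \<equiv> q^2 * (1 - e)^3" and "\<beta> \<equiv> q * (1 - q*e)^3 * (q - e) / (1 - q^2*e)"
  shows "(\<Sum>k\<le>m. \<alpha> * jackson_term q e k - \<beta> * jackson_term q (e * q^3) k) =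
    q * e * (1 - q * e^2) * (q_pochhammer q (q^3) m / q_pochhammer (q^3) (q^3) m)^4 *
    (1 - q * (q^3)^m)^4 * q_pochhammer (e * q^3) (q^3) m * q_pochhammer (q^2/e) (q^3) m /
    (q_pochhammer (q^4/e) (q^3) m * q_pochhammer (q^2*e) (q^3) (Suc m))"
    (is "_ = ?G m")
proof (induction m)
  case 0
  have "1 - q^2*e \<noteq> 0" using ne(2)[of 2] by auto
  \<comment> \<open>At \<open>k = 0\<close> both Jackson terms equal \<open>1 - q\<close>.\<close>
  then have "(1 - q) * (\<alpha> - \<beta>) = q * e * (1 - q*e^2) * (1 - q)^4 / (1 - q^2*e)"
    by (simp add: \<alpha>_def \<beta>_def field_simps) algebra
  then show ?case
    by (simp add: jackson_term_def q_pochhammer_Suc algebra_simps)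
next
  case (Suc m)
  define p where "p = q^3"
  define X where "X = p ^ Suc m"
  define c where "c = q_pochhammer q p (Suc m) / q_pochhammer p p (Suc m)"
  define U where "U = q_pochhammer (e*p) p m"
  define V where "V = q_pochhammer (q^2/e) p m"
  define W where "W = q_pochhammer (q^4/e) p m"
  define Z where "Z = q_pochhammer (q^2*e) p (Suc m)"
  have pX: "p ^ Suc m = X" and X: "q ^ (3 * Suc m) = X"
    unfolding X_def p_def by (simp, rule power_mult)
  have pm: "p ^ m = X / q^3" using q by (simp add: X_def p_def)
  have nz: "W \<noteq> 0" "Z \<noteq> 0"
    unfolding W_def Z_def p_def using ne(1)[of "Suc _"] ne(2)[of "2 + 3 * _"] e
    by (intro q_pochhammer_nonzero; simp add: field_simps power_add power_mult eval_nat_numeral)+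
  have nz1: "1 - X \<noteq> 0" "1 - q*X/e \<noteq> 0" "1 - q^2*e*X \<noteq> 0" "1 - q / e \<noteq> 0" "1 - q^2*e \<noteq> 0"
    using q(2)[of "3 * Suc m"] ne(1)[of "Suc m"] ne(1)[of 0] ne(2)[of 2]
      ne(2)[of "2 + 3 * Suc m"] e unfolding X[symmetric]
    by (auto simp: power_add mult_ac)
  \<comment> \<open>The symbols for \<open>e\<close> and for \<open>e * p\<close> differ only in end
    factors, so all four quantities of the induction step become c^4 U V / (W Z) times a rational
    function of \<open>X\<close>, \<open>q\<close> and \<open>e\<close>.\<close>
  have eU: "q_pochhammer e p (Suc m) = (1 - e) * U"
    using q_pochhammer_shift[of e p m] by (simp add: U_def q_pochhammer_Suc)
  have eU': "q_pochhammer (e*p) p (Suc m) = U * (1 - e*X)"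
    by (simp add: U_def q_pochhammer_Suc X_def mult.assoc)
  have fV: "q_pochhammer (q^2/e) p (Suc m) = V * (1 - X/(e*q))"
    using q by (simp add: V_def q_pochhammer_Suc pm field_simps power2_eq_square power3_eq_cube)
  have fV': "q_pochhammer (q^2/(e*p)) p (Suc m) = (1 - 1/(e*q)) * V"
    using q_pochhammer_shift[of "q^2/(e*p)" p m] q e
    by (simp add: V_def q_pochhammer_Suc p_def power2_eq_square power3_eq_cube)
  have gW: "q_pochhammer (q^4/e) p (Suc m) = W * (1 - q*X/e)"
    using q by (simp add: W_def q_pochhammer_Suc pm power2_eq_square power3_eq_cube eval_nat_numeral)
  have gW': "(1 - q/e) * W = q_pochhammer (q^4/(e*p)) p (Suc m)"
    using q_pochhammer_shift[of "q/e" p m] q e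
    by (simp add: W_def q_pochhammer_Suc p_def eval_nat_numeral)
  have hZ: "q_pochhammer (q^2*e) p (Suc (Suc m)) = Z * (1 - q^2*e*X)"
    by (simp add: Z_def q_pochhammer_Suc[of _ _ "Suc m"] X_def)
  have hZ': "q_pochhammer (q^2*(e*p)) p (Suc m) = Z * (1 - q^2*e*X) / (1 - q^2*e)"
    using q_pochhammer_shift[of "q^2*e" p "Suc m"] nz1
    by (simp add: Z_def X_def field_simps)
  have cm: "q_pochhammer q p m / q_pochhammer p p m * (1 - q * p^m) = c * (1 - X)"
    unfolding c_def q_pochhammer_Suc using nz1(1) by (simp add: X_def)
  have X6: "1 - q ^ (6 * Suc m + 1) = 1 - q * X^2"
    by (simp add: X_def p_def flip: power_mult power_Suc)
  have t1: "\<alpha> * jackson_term q e (Suc m) =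
      (1 - q*X^2) * c^4 * U * V * X * (q^2*(1 - e)^4 * (1 - X/(e*q))) / (W * (1 - q*X/e) * Z)"
    unfolding jackson_term_def X6 X unfolding p_def[symmetric] eU fV gW Z_def[symmetric] c_def[symmetric] \<alpha>_def
    by (simp add: power3_eq_cube eval_nat_numeral)
  have t2: "\<beta> * jackson_term q (e * q^3) (Suc m) =
      (1 - q*X^2) * c^4 * U * V * X * ((1 - q*e)^4 * (1 - e*X)) / (W * Z * (1 - q^2*e*X))"
  proof -
    have "\<beta> * jackson_term q (e * q^3) (Suc m) =
      (1 - q*X^2) * c^4 * U * V * X * (\<beta> * (1 - 1/(e*q)) * (1 - q^2*e) / (1 - q/e) * (1 - e*X))
        / (W * Z * (1 - q^2*e*X))"
      unfolding jackson_term_def X6 X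
      unfolding p_def[symmetric] eU' fV' gW'[symmetric] hZ' c_def[symmetric]
      by (simp add: mult_ac)
    \<comment> \<open>The form of \<beta> comes from here: \<open>q - e\<close> and
      \<open>1 - q^2*e\<close> absorb the end factors produced by shifting \<open>e\<close>, and the
      remaining (1 - q e)/q completes the fourth power.\<close>
    also have "\<beta> * (1 - 1/(e*q)) * (1 - q^2*e) / (1 - q/e) = (1 - q*e)^4"
    proof -
      have "q - e \<noteq> 0" using ne(1)[of 0] by auto
      then have "(q - e) * (1 - 1/(e*q)) / (1 - q/e) = (1 - q*e) / q"
        using e q nz1(4) by (simp add: divide_simps) (simp add: algebra_simps)
      moreover have "\<beta> * (1 - 1/(e*q)) * (1 - q^2*e) / (1 - q/e)
          = q * (1 - q*e)^3 * ((q - e) * (1 - 1/(e*q)) / (1 - q/e))"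
        using nz1(5) by (simp add: \<beta>_def)
      ultimately show ?thesis using q by (simp add: eval_nat_numeral)
    qed
    finally show ?thesis .
  qed
  have t3: "?G m = q*e*(1 - q*e^2) * c^4 * (1 - X)^4 * U * V / (W * Z)"
  proof -
    have "?G m = q*e*(1 - q*e^2) * (q_pochhammer q p m / q_pochhammer p p m * (1 - q * p^m))^4 * U * V / (W * Z)"
      unfolding U_def V_def W_def Z_def p_def by (simp only: power_mult_distrib[of _ "1 - q * _"] mult.assoc)
    then show ?thesis unfolding cm by (simp add: power_mult_distrib)
  qed
  have t4: "?G (Suc m) = q*e*(1 - q*e^2) * c^4 * (1 - q*X)^4 * U * (1 - e*X) * V * (1 - X/(e*q))
     / (W * (1 - q*X/e) * (Z * (1 - q^2*e*X)))"
    unfolding p_def[symmetric] eU' fV gW hZ c_def[symmetric] pX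
    by (simp add: mult_ac)
  have "?G m + (\<alpha> * jackson_term q e (Suc m) - \<beta> * jackson_term q (e * q^3) (Suc m)) = ?G (Suc m)"
  proof -
    define D where "D = W * (1 - q*X/e) * (Z * (1 - q^2*e*X))"
    have cancel: "a * x / (b * x) = a / b" if "x \<noteq> 0" for a b x :: 'a
      using that by simp
    have t1': "\<alpha> * jackson_term q e (Suc m) =
        (1 - q*X^2) * c^4 * U * V * X * (q^2*(1 - e)^4 * (1 - X/(e*q))) * (1 - q^2*e*X) / D"
      unfolding t1 D_def using nz1 by (simp add: mult_ac)
    have t2': "\<beta> * jackson_term q (e * q^3) (Suc m) =
        (1 - q*X^2) * c^4 * U * V * X * ((1 - q*e)^4 * (1 - e*X)) * (1 - q*X/e) / D"
      unfolding t2 D_def by (subst cancel[OF nz1(2), symmetric]) (simp only: mult_ac)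
    have t3': "?G m = q*e*(1 - q*e^2) * c^4 * (1 - X)^4 * U * V * (1 - q*X/e) * (1 - q^2*e*X) / D"
      unfolding t3 D_def using nz1(2,3)
      by (subst cancel[of "(1 - q*X/e) * (1 - q^2*e*X)", symmetric]) (simp, simp only: mult_ac)
    \<comment> \<open>Over the common denominator \<open>D\<close> and up to the factor c^4 U V,
      this is \<open>jackson_certificate\<close> with X = q^(3(m+1)).\<close>
    show ?thesis
      unfolding t1' t2' t3' t4 D_def[symmetric] add_divide_distrib[symmetric] diff_divide_distrib[symmetric]
      by (rule arg_cong[where f = "\<lambda>x. x / D"])
         (use arg_cong[OF jackson_certificate[OF e(1) q(1), of X], of "\<lambda>x. c^4 * U * V * x"]
          in \<open>simp only: algebra_simps\<close>)
  qed
  with Suc.IH show ?case by simp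
qed

lemma power_eq_power_iff:
  fixes q :: "'a :: field"
  assumes "q \<noteq> 0" "\<And>m. m > 0 \<Longrightarrow> q ^ m \<noteq> 1"
  shows "q ^ a = q ^ b \<longleftrightarrow> a = b"
proof (induction a b rule: linorder_wlog)
  case (le a b)
  then have "q ^ b = q ^ a * q ^ (b - a)" by (simp flip: power_add)
  then show ?case using assms(1) assms(2)[of "b - a"] le by (cases "a = b") auto
qed (auto simp: eq_commute)

text \<open>For e = q^(3N+2) one has q^2/e = q^(-3N), hence (q^2/e; q^3)_(N+1) = 0. The closed form
  of the partial sum up to N+1 vanishes, and the quotient of the two sums is
  \<alpha>/\<beta>.\<close>

lemma jackson_recurrence:
  fixes q :: "'a :: field" and N :: nat
  assumes q: "q \<noteq> 0" "\<And>m. m > 0 \<Longrightarrow> q ^ m \<noteq> 1"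
  defines "e \<equiv> q ^ (3 * N + 2)"
  shows "(\<Sum>k\<le>Suc N. jackson_term q (q ^ (3 * Suc N + 2)) k) =
    (1 - q ^ (3*N+4)) * (1 - q ^ (3*N+2))^3 / ((1 - q ^ (3*N+3))^3 * (1 - q ^ (3*N+1)))
      * (\<Sum>k\<le>N. jackson_term q e k)"
proof -
  have e: "e \<noteq> 0" "e \<noteq> 1" using q(1) q(2)[of "3 * N + 2"] by (auto simp: e_def)
  have eq: "q ^ a = q ^ b \<longleftrightarrow> a = b" for a b
    by (rule power_eq_power_iff) (use q in auto)
  have ne: "q * q ^ (3 * m) \<noteq> e" "q ^ m * e \<noteq> 1" for m
  proof -
    have "Suc (3 * m) \<noteq> 3 * N + 2" by presburger
    then show "q * q ^ (3 * m) \<noteq> e"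
      unfolding e_def power_Suc[symmetric] eq .
    show "q ^ m * e \<noteq> 1"
      unfolding e_def power_add[symmetric] by (intro q(2)) simp
  qed
  define \<alpha> \<beta> where "\<alpha> = q^2 * (1 - e)^3" and "\<beta> = q * (1 - q*e)^3 * (q - e) / (1 - q^2*e)"
  have nz: "1 - q * e \<noteq> 0" "1 - q^2 * e \<noteq> 0" "q - e \<noteq> 0"
    using ne(2)[of 1] ne(2)[of 2] ne(1)[of 0] by auto
  have "(q^2/e) * (q^3)^N = 1"
    using q by (simp add: e_def power_add power2_eq_square flip: power_mult)
  then have last: "q_pochhammer (q^2/e) (q^3) (Suc N) = 0"
    by (simp add: q_pochhammer_Suc)
  have "\<alpha> * (\<Sum>k\<le>Suc N. jackson_term q e k) - \<beta> * (\<Sum>k\<le>Suc N. jackson_term q (e * q^3) k) = 0"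
    using jackson_partial_sum[OF q e ne, of "Suc N"] unfolding last
    by (simp only: sum_distrib_left sum_subtractf \<alpha>_def \<beta>_def) simp
  \<comment> \<open>The sum for \<open>e\<close> already terminates at \<open>N\<close>; the one for
    \<open>e * q^3\<close> runs to \<open>Suc N\<close>.\<close>
  moreover have "(\<Sum>k\<le>Suc N. jackson_term q e k) = (\<Sum>k\<le>N. jackson_term q e k)"
    by (simp add: jackson_term_def last)
  moreover have "\<beta> \<noteq> 0" using nz q by (simp add: \<beta>_def)
  ultimately have "(\<Sum>k\<le>Suc N. jackson_term q (e * q^3) k) = \<alpha> / \<beta> * (\<Sum>k\<le>N. jackson_term q e k)"
    by (simp add: field_simps)
  moreover have "\<alpha> / \<beta> = (1 - q^2*e) * (1 - e)^3 / ((1 - q*e)^3 * (1 - e/q))"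
    using nz q by (simp add: \<alpha>_def \<beta>_def divide_simps power2_eq_square)
  moreover have "e * q^3 = q ^ (3 * Suc N + 2)" "q^2*e = q^(3*N+4)" "q*e = q^(3*N+3)" "e/q = q^(3*N+1)"
    using q(1) by (simp_all only: e_def) (simp_all add: power_add eval_nat_numeral)
  ultimately show ?thesis by (simp only: e_def)
qed

lemma jackson_sum:
  fixes q :: "'a :: field"
  assumes q: "q \<noteq> 0" "\<And>m. m > 0 \<Longrightarrow> q ^ m \<noteq> 1"
  shows "(\<Sum>k\<le>N. jackson_term q (q ^ (3 * N + 2)) k) = (1 - q) *
    (\<Prod>j<N. (1 - q ^ (3*j+4)) * (1 - q ^ (3*j+2))^3 / ((1 - q ^ (3*j+3))^3 * (1 - q ^ (3*j+1))))"
proof (induction N)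
  case 0
  show ?case by (simp add: jackson_term_def)
next
  case (Suc N)
  show ?case
    using jackson_recurrence[OF q, of N] unfolding Suc.IH prod.lessThan_Suc by (simp only: mult_ac)
qed

section \<open>Local rings of rational functions\<close>

abbreviation cpoly :: "int poly \<Rightarrow> complex poly" where
  "cpoly \<equiv> map_poly of_int"

lemma cpoly_add: "cpoly (p + q) = cpoly p + cpoly q"
  by (rule poly_eqI) (simp add: coeff_map_poly)

lemma cpoly_diff: "cpoly (p - q) = cpoly p - cpoly q"
  by (rule poly_eqI) (simp add: coeff_map_poly)

lemma cpoly_mult: "cpoly (p * q) = cpoly p * cpoly q"
  by (rule poly_eqI) (simp add: coeff_map_poly coeff_mult)

lemma degree_cpoly: "degree (cpoly p) = degree p"
  by (rule degree_map_poly) auto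

lemma cpoly_eq_0_iff [simp]: "cpoly p = 0 \<longleftrightarrow> p = 0"
  by (simp add: map_poly_eq_0_iff)

text \<open>Division by a monic polynomial stays in Z[q]. The remainder is divisible over the
  complex numbers by a polynomial of larger degree, so it is 0.\<close>

lemma cpoly_dvd_monic:
  fixes P N :: "int poly"
  assumes monic: "lead_coeff P = 1" and dvd: "cpoly P dvd cpoly N"
  shows "P dvd N"
proof -
  have P0: "P \<noteq> 0" using monic by auto
  obtain s r where sr: "pseudo_divmod N P = (s, r)" by (cases "pseudo_divmod N P")
  from pseudo_divmod[OF P0 sr] monic have N: "N = P * s + r"
    and r: "r = 0 \<or> degree r < degree P" by auto
  have "cpoly P dvd cpoly r"
    using dvd unfolding N by (simp add: cpoly_add cpoly_mult dvd_add_right_iff)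
  then have "r = 0"
    using r dvd_imp_degree_le[of "cpoly P" "cpoly r"] by (fastforce simp: degree_cpoly)
  then show ?thesis using N by simp
qed

lemma power_linear_dvd_cancel:
  fixes p q :: "'a :: field poly"
  assumes "[:- a, 1:] ^ m dvd p * q" and "poly q a \<noteq> 0"
  shows "[:- a, 1:] ^ m dvd p"
proof (cases "p = 0")
  case False
  then have "p * q \<noteq> 0" using assms(2) by auto
  moreover have "order a q = 0" using assms(2) by (simp add: order_0I)
  ultimately show ?thesis
    using assms(1) by (simp add: order_divides order_mult)
qed simp

text \<open>Powers of distinct linear factors are coprime: after division by those already treated,
  the quotient must absorb the next one.\<close>

lemma prod_linear_power_dvd:
  fixes p :: "'a :: field poly"
  assumes "finite A" "\<And>a. a \<in> A \<Longrightarrow> [:- a, 1:] ^ m a dvd p"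
  shows "(\<Prod>a\<in>A. [:- a, 1:] ^ m a) dvd p"
  using assms
proof (induction A rule: finite_induct)
  case (insert a A)
  then obtain q where q: "p = q * (\<Prod>a\<in>A. [:- a, 1:] ^ m a)" by (auto simp: dvd_def mult.commute)
  have "poly (\<Prod>a\<in>A. [:- a, 1:] ^ m a) a \<noteq> 0"
    using insert.hyps by (auto simp: poly_prod)
  with insert.prems[of a] q have "[:- a, 1:] ^ m a dvd q"
    by (auto intro: power_linear_dvd_cancel)
  then show ?case using insert.hyps q by (simp add: mult_dvd_mono)
qed simp

text \<open>\<open>has_value z x c\<close>: \<open>x\<close> is regular at \<open>z\<close> with value \<open>c\<close>. \<open>vanishes z m x\<close>: \<open>x\<close> lies in the \<open>m\<close>-th
  power of the maximal ideal of the local ring at \<open>z\<close>, so regularity at \<open>z\<close> is part of it.\<close>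

definition has_value :: "complex \<Rightarrow> int poly fract \<Rightarrow> complex \<Rightarrow> bool" where
  "has_value z x c \<longleftrightarrow> (\<exists>u v. x * to_fract v = to_fract u \<and> poly (cpoly v) z \<noteq> 0 \<and>
     poly (cpoly u) z = c * poly (cpoly v) z)"

definition vanishes :: "complex \<Rightarrow> nat \<Rightarrow> int poly fract \<Rightarrow> bool" where
  "vanishes z m x \<longleftrightarrow> (\<exists>u v. x * to_fract v = to_fract u \<and> poly (cpoly v) z \<noteq> 0 \<and>
     [:- z, 1:] ^ m dvd cpoly u)"

lemma has_value_to_fract: "has_value z (to_fract p) (poly (cpoly p) z)"
  unfolding has_value_def by (rule exI[of _ p], rule exI[of _ 1]) (simp add: map_poly_1)

lemma has_value_0 [simp]: "has_value z 0 0"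
  using has_value_to_fract[of z 0] by simp

lemma has_value_1 [simp]: "has_value z 1 1"
  using has_value_to_fract[of z 1] by (simp add: map_poly_1)

lemma has_value_qvar [simp]: "has_value z qvar z"
  using has_value_to_fract[of z "[:0, 1:]"] by (simp add: qvar_def map_poly_pCons)

lemma has_value_mult:
  assumes "has_value z x c" "has_value z y d"
  shows "has_value z (x * y) (c * d)"
proof -
  obtain u v u' v' where
    uv: "x * to_fract v = to_fract u" "poly (cpoly v) z \<noteq> 0" "poly (cpoly u) z = c * poly (cpoly v) z"
    "y * to_fract v' = to_fract u'" "poly (cpoly v') z \<noteq> 0" "poly (cpoly u') z = d * poly (cpoly v') z"
    using assms unfolding has_value_def by blast
  then show ?thesis unfolding has_value_def
    by (intro exI[of _ "u * u'"] exI[of _ "v * v'"]) (simp add: cpoly_mult mult_ac flip: uv(1,4))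
qed

lemma has_value_add:
  assumes "has_value z x c" "has_value z y d"
  shows "has_value z (x + y) (c + d)"
proof -
  obtain u v u' v' where
    uv: "x * to_fract v = to_fract u" "poly (cpoly v) z \<noteq> 0" "poly (cpoly u) z = c * poly (cpoly v) z"
    "y * to_fract v' = to_fract u'" "poly (cpoly v') z \<noteq> 0" "poly (cpoly u') z = d * poly (cpoly v') z"
    using assms unfolding has_value_def by blast
  then show ?thesis unfolding has_value_def
    by (intro exI[of _ "u * v' + u' * v"] exI[of _ "v * v'"])
      (auto simp: cpoly_mult cpoly_add algebra_simps)
qed

lemma has_value_diff:
  assumes "has_value z x c" "has_value z y d"
  shows "has_value z (x - y) (c - d)"
proof -
  obtain u v u' v' where
    uv: "x * to_fract v = to_fract u" "poly (cpoly v) z \<noteq> 0" "poly (cpoly u) z = c * poly (cpoly v) z"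
    "y * to_fract v' = to_fract u'" "poly (cpoly v') z \<noteq> 0" "poly (cpoly u') z = d * poly (cpoly v') z"
    using assms unfolding has_value_def by blast
  then show ?thesis unfolding has_value_def
    by (intro exI[of _ "u * v' - u' * v"] exI[of _ "v * v'"])
      (auto simp: cpoly_mult cpoly_diff algebra_simps)
qed

lemma has_value_inverse:
  assumes "has_value z x c" "c \<noteq> 0"
  shows "has_value z (inverse x) (inverse c)"
proof -
  obtain u v where uv: "x * to_fract v = to_fract u" "poly (cpoly v) z \<noteq> 0"
    "poly (cpoly u) z = c * poly (cpoly v) z"
    using assms unfolding has_value_def by blast
  then have "u \<noteq> 0" using assms(2) by auto
  with uv(1) have "x \<noteq> 0" by auto
  with uv assms(2) show ?thesis unfolding has_value_def
    by (intro exI[of _ v] exI[of _ u]) (auto simp flip: uv(1))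
qed

lemma has_value_divide:
  "has_value z x c \<Longrightarrow> has_value z y d \<Longrightarrow> d \<noteq> 0 \<Longrightarrow> has_value z (x / y) (c / d)"
  unfolding divide_inverse by (intro has_value_mult has_value_inverse)

lemma has_value_power: "has_value z x c \<Longrightarrow> has_value z (x ^ k) (c ^ k)"
  by (induction k) (auto intro: has_value_mult)

lemma has_value_prod:
  "(\<And>i. i \<in> A \<Longrightarrow> has_value z (f i) (g i)) \<Longrightarrow> has_value z (prod f A) (prod g A)"
  by (induction A rule: infinite_finite_induct) (auto intro: has_value_mult)

lemma has_value_sum:
  "(\<And>i. i \<in> A \<Longrightarrow> has_value z (f i) (g i)) \<Longrightarrow> has_value z (sum f A) (sum g A)"
  by (induction A rule: infinite_finite_induct) (auto intro: has_value_add)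

lemmas has_value_intros = has_value_add has_value_mult has_value_diff has_value_divide
  has_value_power has_value_prod has_value_sum has_value_0 has_value_1 has_value_qvar

section \<open>Orders of vanishing at a point\<close>

lemma vanishes_1: "has_value z x 0 \<Longrightarrow> vanishes z 1 x"
  unfolding has_value_def vanishes_def by (auto simp: poly_eq_0_iff_dvd)

lemma vanishes_0 [simp]: "vanishes z m 0"
  unfolding vanishes_def by (intro exI[of _ 0] exI[of _ 1]) (simp add: map_poly_1)

lemma vanishes_mult:
  assumes "vanishes z k x" "vanishes z m y"
  shows "vanishes z (k + m) (x * y)"
proof -
  obtain u v u' v' where
    uv: "x * to_fract v = to_fract u" "poly (cpoly v) z \<noteq> 0" "[:- z, 1:] ^ k dvd cpoly u"
    "y * to_fract v' = to_fract u'" "poly (cpoly v') z \<noteq> 0" "[:- z, 1:] ^ m dvd cpoly u'"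
    using assms unfolding vanishes_def by blast
  then show ?thesis unfolding vanishes_def
    by - (rule exI[of _ "u * u'"], rule exI[of _ "v * v'"],
      use mult_dvd_mono[OF uv(3,6)] in \<open>simp add: cpoly_mult power_add mult_ac flip: uv(1,4)\<close>)
qed

lemma vanishes_mult_regular:
  assumes "vanishes z m x" "has_value z y c"
  shows "vanishes z m (x * y)"
  using vanishes_mult[OF assms(1), of 0 y] assms(2) unfolding vanishes_def has_value_def by auto

lemma vanishes_add:
  assumes "vanishes z m x" "vanishes z m y"
  shows "vanishes z m (x + y)"
proof -
  obtain u v u' v' where
    uv: "x * to_fract v = to_fract u" "poly (cpoly v) z \<noteq> 0" "[:- z, 1:] ^ m dvd cpoly u"
    "y * to_fract v' = to_fract u'" "poly (cpoly v') z \<noteq> 0" "[:- z, 1:] ^ m dvd cpoly u'"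
    using assms unfolding vanishes_def by blast
  then show ?thesis unfolding vanishes_def
    by (intro exI[of _ "u * v' + u' * v"] exI[of _ "v * v'"])
      (auto simp: cpoly_mult cpoly_add algebra_simps)
qed

lemma vanishes_sum:
  "(\<And>i. i \<in> A \<Longrightarrow> vanishes z m (f i)) \<Longrightarrow> vanishes z m (sum f A)"
  by (induction A rule: infinite_finite_induct) (auto intro: vanishes_add)

text \<open>A fraction u/v witnessing the vanishing need not be reduced. Comparison with the reduced
  fraction N/D gives N v = u D, and \<open>v\<close>, being nonzero at \<open>z\<close>,
  cancels.\<close>

lemma vanishes_numerator:
  assumes "vanishes z m x"
  shows "[:- z, 1:] ^ m dvd cpoly (fst (quot_of_fract x))"
proof -
  define N D where "N = fst (quot_of_fract x)" and "D = snd (quot_of_fract x)"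
  have D: "D \<noteq> 0" and x: "x = to_fract N / to_fract D"
    using Fract_quot_of_fract[of x] by (simp_all add: N_def D_def Fract_conv_to_fract)
  obtain u v where uv: "x * to_fract v = to_fract u" "poly (cpoly v) z \<noteq> 0" "[:- z, 1:] ^ m dvd cpoly u"
    using assms unfolding vanishes_def by blast
  then have "to_fract (N * v) = to_fract (u * D)"
    using D x by (simp add: field_simps)
  then have "N * v = u * D" by (simp only: to_fract_eq_iff)
  then have "cpoly N * cpoly v = cpoly u * cpoly D" by (metis cpoly_mult)
  then have "[:- z, 1:] ^ m dvd cpoly N * cpoly v" using uv(3) by simp
  then show ?thesis using uv(2) unfolding N_def by (rule power_linear_dvd_cancel)
qed

section \<open>Vanishing at roots of unity\<close>

text \<open>This is (q; q^3)_k / (q^3; q^3)_k, written as one product of quotients so that blocks of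
  factors split off and are evaluated factor by factor.\<close>

definition poch_ratio :: "'a :: field \<Rightarrow> nat \<Rightarrow> 'a" where
  "poch_ratio q k = (\<Prod>j<k. (1 - q ^ (3 * j + 1)) / (1 - q ^ (3 * j + 3)))"

lemma poch_ratio_eq: "q_pochhammer q (q ^ 3) k / q_pochhammer (q ^ 3) (q ^ 3) k = poch_ratio q k"
  by (simp add: q_pochhammer_def poch_ratio_def prod_dividef power_add mult_ac flip: power_mult)

lemma poch_ratio_add:
  "poch_ratio q (k + r) = poch_ratio q k * (\<Prod>j<r. (1 - q ^ (3 * (k + j) + 1)) / (1 - q ^ (3 * (k + j) + 3)))"
  unfolding poch_ratio_def by (induction r) (simp_all add: mult.assoc)

definition summand :: "nat \<Rightarrow> int poly fract" where
  "summand k = q_int qvar (6 * k + 1) * poch_ratio qvar k ^ 6 * qvar ^ (3 * k)"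

lemma qvar_power_neq_1: "m > 0 \<Longrightarrow> qvar ^ m \<noteq> 1"
proof
  assume m: "m > 0" and "qvar ^ m = 1"
  moreover have "qvar ^ m = to_fract ([:0, 1:] ^ m)"
    by (induction m) (simp_all add: qvar_def del: mult_pCons_left)
  ultimately have "[:0, 1:] ^ m = (1 :: int poly)" by (metis to_fract_1 to_fract_eq_iff)
  then have "poly ([:0, 1:] ^ m) 2 = (1 :: int)" by simp
  then show False using m by (simp add: poly_power)
qed

lemma qvar_nonzero: "qvar \<noteq> 0"
  by (simp add: qvar_def)

text \<open>At a primitive \<open>d\<close>-th root of unity, \<open>q = (q\<^sup>3)\<^sup>-\<^sup>N\<close>: among the terms with \<open>k < d\<close>, the
  last nonzero one has \<open>k = N\<close>.\<close>

locale root_of_unity =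
  fixes z :: complex and d N :: nat
  assumes root: "z ^ m = 1 \<longleftrightarrow> d dvd m" and d: "d > 1" "coprime d 3"
    and N: "N < d" "d dvd 3 * N + 1"
begin

lemma z_nonzero: "z \<noteq> 0" and z_neq_1: "z \<noteq> 1"
proof -
  show "z \<noteq> 1" using root[of 1] d by auto
  show "z \<noteq> 0" using root[of d] d by (intro notI) (simp add: power_0_left)
qed

lemma dvd_3_mult_iff: "d dvd 3 * m \<longleftrightarrow> d dvd m"
  using d by (simp add: coprime_dvd_mult_right_iff)

text \<open>As 3 is invertible modulo \<open>d\<close>, the first zero among the denominators is at
  j = d - 1. Products of fewer than \<open>d\<close> factors can therefore be evaluated at
  \<open>z\<close>.\<close>

lemma denominator_nonzero: "j + 1 < d \<Longrightarrow> 1 - z ^ (3 * j + 3) \<noteq> 0"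
  using root[of "3 * j + 3"] dvd_3_mult_iff[of "j + 1"] dvd_imp_le[of d "j + 1"]
  by (auto simp: algebra_simps)

lemma numerator_zero_iff:
  assumes "j < d"
  shows "1 - z ^ (3 * j + 1) = 0 \<longleftrightarrow> j = N"
proof -
  have "d dvd 3 * j + 1 \<longleftrightarrow> j = N"
  proof
    assume "d dvd 3 * j + 1"
    then have "[3 * j + 1 = 3 * N + 1] (mod d)"
      using N(2) by (metis cong_0_iff cong_sym cong_trans)
    then have "[j = N] (mod d)"
      using d(2) by (metis cong_add_rcancel_nat cong_mult_lcancel_nat coprime_commute)
    then show "j = N" using assms N(1) by (simp add: cong_less_modulus_unique_nat)
  qed (use N in simp)
  then show ?thesis using root[of "3 * j + 1"] by auto
qed

lemma poch_ratio_eq_0: "N < r \<Longrightarrow> poch_ratio z r = 0"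
  using numerator_zero_iff[OF N(1)] by (auto simp: poch_ratio_def)

text \<open>Since z^(3N+1) = 1, the factor at m = N - r - 1 is built from 1/A and 1/(A z^2) with A =
  z^(3r+1). Inverting these turns its reciprocal into z^2 times the factor at \<open>r\<close>, so
  each step down from \<open>N\<close> contributes z^2 and one factor of
  \<open>poch_ratio z r\<close>.\<close>

lemma poch_ratio_reflect: "r \<le> N \<Longrightarrow> poch_ratio z (N - r) = z ^ (2 * r) * poch_ratio z N * poch_ratio z r"
proof (induction r)
  case 0
  show ?case by (simp add: poch_ratio_def)
next
  case (Suc r)
  define m where "m = N - Suc r"
  define A where "A = z ^ (3 * r + 1)"
  have Nm: "N = m + r + 1" "N - r = Suc m" using Suc.prems by (simp_all add: m_def)
  have root1: "z ^ (3 * N + 1) = 1" using root[of "3 * N + 1"] N by blast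
  have nz: "1 - z ^ (3 * m + 3) \<noteq> 0" "1 - z ^ (3 * m + 1) \<noteq> 0" "1 - A * z^2 \<noteq> 0"
    using denominator_nonzero[of m] denominator_nonzero[of r] numerator_zero_iff[of m] Nm N
    by (simp_all add: A_def eval_nat_numeral mult_ac)
  have A0: "A \<noteq> 0" using z_nonzero by (simp add: A_def)
  have "3 * m + 3 + (3 * r + 1) = 3 * N + 1" "3 * m + 1 + (3 * r + 1 + 2) = 3 * N + 1"
    using Nm by simp_all
  then have "z ^ (3 * m + 3) * A = 1" "z ^ (3 * m + 1) * (A * z^2) = 1"
    using root1 unfolding A_def by (metis power_add)+
  then have e1: "z ^ (3 * m + 3) = 1 / A" and e2: "z ^ (3 * m + 1) = 1 / (A * z^2)"
    using A0 z_nonzero by (simp_all add: field_simps)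
  have "poch_ratio z (Suc m) = poch_ratio z m * ((1 - z ^ (3 * m + 1)) / (1 - z ^ (3 * m + 3)))"
    by (simp add: poch_ratio_def)
  then have "poch_ratio z m = poch_ratio z (Suc m) * ((1 - z ^ (3 * m + 3)) / (1 - z ^ (3 * m + 1)))"
    using nz by simp
  also have "(1 - z ^ (3 * m + 3)) / (1 - z ^ (3 * m + 1)) = z^2 * ((1 - A) / (1 - A * z^2))"
    using nz(2,3) A0 z_nonzero unfolding e1 e2 by (simp add: divide_simps) algebra
  also have "poch_ratio z (Suc m) = z ^ (2 * r) * poch_ratio z N * poch_ratio z r"
    using Suc by (simp add: Nm)
  finally show ?case
    by (simp add: m_def poch_ratio_def A_def power_add eval_nat_numeral mult_ac)
qed

text \<open>The sign comes from the first factor: z^(6N+2) = 1 makes z^(6(N-r)+1) the inverse of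
  z^(6r+1). The remaining powers of \<open>z\<close> cancel against those of the reflected sixth
  power.\<close>

lemma reflected_term:
  assumes "r \<le> N"
  shows "(1 - z ^ (6 * (N - r) + 1)) * poch_ratio z (N - r) ^ 6 * z ^ (3 * (N - r)) =
    - ((1 - z ^ (6 * r + 1)) * poch_ratio z r ^ 6 * z ^ (3 * r))"
proof -
  define w y C where "w = z ^ (N - r)" and "y = z ^ r" and "C = poch_ratio z N"
  have nz: "w \<noteq> 0" "y \<noteq> 0" using z_nonzero by (simp_all add: w_def y_def)
  have wy: "z ^ N = w * y" using assms by (simp add: w_def y_def flip: power_add)
  have "z ^ (3 * N + 1) = (z ^ N) ^ 3 * z" by (simp add: mult.commute flip: power_mult)
  then have 1: "(w * y) ^ 3 * z = 1" using root[of "3 * N + 1"] N unfolding wy by metis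
  have "z ^ (2 * N) = (z ^ N) ^ 2" by (simp add: mult.commute flip: power_mult)
  \<comment> \<open>The reflection at \<open>r = N\<close>, whose left side is
    \<open>poch_ratio z 0 = 1\<close>, determines C^2.\<close>
  then have "(w * y) ^ 2 * C ^ 2 = 1"
    using poch_ratio_reflect[of N] unfolding wy
    by (simp add: C_def poch_ratio_def power2_eq_square mult.assoc)
  then have "((w * y) ^ 2 * C ^ 2) ^ 3 = 1" by simp
  then have 2: "w ^ 6 * y ^ 6 * C ^ 6 = 1" by (simp add: power_mult_distrib flip: power_mult)
  have "w ^ 3 * ((1 - w ^ 6 * z) * (y ^ 2 * C) ^ 6 * w ^ 3)
      = (w ^ 6 * y ^ 6 * C ^ 6) * (y ^ 6 - w ^ 3 * y ^ 3 * ((w * y) ^ 3 * z))"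
    by (simp add: power_mult_distrib eval_nat_numeral algebra_simps)
  also have "\<dots> = w ^ 3 * - (y ^ 3 - y ^ 6 * ((w * y) ^ 3 * z) / w ^ 3)"
    unfolding 1 2 using nz by (simp add: field_simps)
  also have "y ^ 6 * ((w * y) ^ 3 * z) / w ^ 3 = y ^ 6 * z * y ^ 3"
    using nz by (simp add: power_mult_distrib)
  finally have "(1 - w ^ 6 * z) * (y ^ 2 * C) ^ 6 * w ^ 3 = - (y ^ 3 - y ^ 6 * z * y ^ 3)"
    by (rule mult_left_cancel[THEN iffD1, rotated]) (use nz in simp)
  also have "\<dots> = - ((1 - y ^ 6 * z) * y ^ 3)" by (simp add: left_diff_distrib)
  finally have main: "(1 - w ^ 6 * z) * (y ^ 2 * C) ^ 6 * w ^ 3 = - ((1 - y ^ 6 * z) * y ^ 3)" .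
  have "(1 - w ^ 6 * z) * (y ^ 2 * C * poch_ratio z r) ^ 6 * w ^ 3 =
      (1 - w ^ 6 * z) * (y ^ 2 * C) ^ 6 * w ^ 3 * poch_ratio z r ^ 6"
    by (simp only: power_mult_distrib mult_ac)
  also have "\<dots> = - ((1 - y ^ 6 * z) * poch_ratio z r ^ 6 * y ^ 3)"
    unfolding main by simp
  finally have "(1 - w ^ 6 * z) * (y ^ 2 * C * poch_ratio z r) ^ 6 * w ^ 3 =
      - ((1 - y ^ 6 * z) * poch_ratio z r ^ 6 * y ^ 3)" .
  moreover have "z ^ (6 * s + 1) = (z ^ s) ^ 6 * z" "z ^ (3 * s) = (z ^ s) ^ 3" for s
    by (simp_all add: mult.commute flip: power_mult)
  moreover have "z ^ (2 * r) = y ^ 2" by (simp add: y_def mult.commute flip: power_mult)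
  ultimately show ?thesis
    unfolding poch_ratio_reflect[OF assms] by (simp only: w_def y_def C_def)
qed

lemma sum_terms_at_root: "(\<Sum>r<d. (1 - z ^ (6 * r + 1)) * poch_ratio z r ^ 6 * z ^ (3 * r)) = 0"
proof -
  let ?t = "\<lambda>r. (1 - z ^ (6 * r + 1)) * poch_ratio z r ^ 6 * z ^ (3 * r)"
  have "sum ?t {..<d} = sum ?t {..N}"
    using N(1) by (intro sum.mono_neutral_right) (auto simp: poch_ratio_eq_0)
  also have "\<dots> = (\<Sum>r\<le>N. ?t (N - r))"
    by (rule sum.reindex_bij_witness[where i = "\<lambda>r. N - r" and j = "\<lambda>r. N - r"]) auto
  also have "\<dots> = (\<Sum>r\<le>N. - ?t r)"
    by (intro sum.cong refl reflected_term) simp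
  also have "\<dots> = - sum ?t {..<d}"
    using \<open>sum ?t {..<d} = sum ?t {..N}\<close> by (simp add: sum_negf)
  finally show ?thesis by simp
qed

section \<open>Reduction of later blocks to the first\<close>

lemma power_period: "z ^ (d * a + b) = z ^ b"
  using root[of "d * a"] by (simp add: power_add)

lemma has_value_shifted_ratio:
  assumes "r < d"
  shows "has_value z (\<Prod>j<r. (1 - qvar ^ (3 * (l * d + j) + 1)) / (1 - qvar ^ (3 * (l * d + j) + 3)))
    (poch_ratio z r)"
  unfolding poch_ratio_def
proof (intro has_value_prod)
  fix j assume "j \<in> {..<r}"
  then have "1 - z ^ (3 * j + 3) \<noteq> 0" using assms denominator_nonzero[of j] by simp
  moreover have "3 * (l * d + j) + i = d * (3 * l) + (3 * j + i)" for i by simp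
  then have "z ^ (3 * (l * d + j) + i) = z ^ (3 * j + i)" for i by (metis power_period)
  ultimately show "has_value z ((1 - qvar ^ (3 * (l * d + j) + 1)) / (1 - qvar ^ (3 * (l * d + j) + 3)))
      ((1 - z ^ (3 * j + 1)) / (1 - z ^ (3 * j + 3)))"
    by (metis has_value_1 has_value_diff has_value_divide has_value_power has_value_qvar)
qed

text \<open>In a full period one numerator (j = N) and one denominator (j = d - 1) vanish at
  \<open>z\<close>. Both are multiples of 1 - q^d; after cancelling it, the denominator has the
  nonzero value 3l + 3.\<close>

lemma poch_ratio_block_regular:
  "\<exists>c. has_value z (\<Prod>j<d. (1 - qvar ^ (3 * (l * d + j) + 1)) / (1 - qvar ^ (3 * (l * d + j) + 3))) c"
proof -
  define f g where "f j = 1 - qvar ^ (3 * (l * d + j) + 1)" and "g j = 1 - qvar ^ (3 * (l * d + j) + 3)" for j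
  obtain a where a: "3 * N + 1 = d * a" using N(2) by (auto elim: dvdE)
  have fN: "f N = (1 - qvar ^ d) * q_int (qvar ^ d) (3 * l + a)"
  proof -
    have "3 * (l * d + N) + 1 = d * (3 * l + a)" using a by (simp add: algebra_simps)
    then show ?thesis unfolding f_def q_int_mult by (simp only: power_mult)
  qed
  have gl: "g (d - 1) = (1 - qvar ^ d) * q_int (qvar ^ d) (3 * l + 3)"
  proof -
    have "3 * (l * d + (d - 1)) + 3 = d * (3 * l + 3)" using d by (simp add: algebra_simps)
    then show ?thesis unfolding g_def q_int_mult by (simp only: power_mult)
  qed
  have period: "z ^ (3 * (l * d + j) + i) = z ^ (3 * j + i)" for i j
  proof -
    have "3 * (l * d + j) + i = d * (3 * l) + (3 * j + i)" by simp
    then show ?thesis by (simp only: power_period)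
  qed
  have zd: "z ^ d = 1" using root[of d] by simp
  have q_int_value: "has_value z (q_int (qvar ^ d) m) (of_nat m)" for m
  proof -
    have "has_value z (q_int (qvar ^ d) m) (\<Sum>i<m. (z ^ d) ^ i)"
      unfolding q_int_def by (intro has_value_intros)
    then show ?thesis by (simp add: zd)
  qed
  have "of_nat (3 * l + 3) \<noteq> (0 :: complex)" unfolding of_nat_eq_0_iff by simp
  moreover have "f N / g (d - 1) = q_int (qvar ^ d) (3 * l + a) / q_int (qvar ^ d) (3 * l + 3)"
    unfolding fN gl using qvar_power_neq_1[of d] d by simp
  ultimately have 1: "has_value z (f N / g (d - 1)) (of_nat (3 * l + a) / of_nat (3 * l + 3))"
    by (simp only: has_value_divide[OF q_int_value q_int_value] not_False_eq_True)
  have "has_value z (f j) (1 - z ^ (3 * (l * d + j) + 1))"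
    "has_value z (g j) (1 - z ^ (3 * (l * d + j) + 3))" for j
    unfolding f_def g_def by (intro has_value_intros)+
  then have "has_value z (f j) (1 - z ^ (3 * j + 1))" "has_value z (g j) (1 - z ^ (3 * j + 3))" for j
    unfolding period .
  then have 2: "has_value z (prod f ({..<d} - {N}) / prod g {..<d - 1})
      ((\<Prod>j\<in>{..<d} - {N}. 1 - z ^ (3 * j + 1)) / (\<Prod>j<d - 1. 1 - z ^ (3 * j + 3)))"
    using denominator_nonzero by (intro has_value_divide has_value_prod) auto
  have "{..<d} = insert (d - 1) {..<d - 1}" using d by auto
  then have "prod g {..<d} = g (d - 1) * prod g {..<d - 1}" by simp
  moreover have "prod f {..<d} = f N * prod f ({..<d} - {N})" using N by (intro prod.remove) auto
  ultimately have "(\<Prod>j<d. f j / g j) = f N / g (d - 1) * (prod f ({..<d} - {N}) / prod g {..<d - 1})"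
    by (simp add: prod_dividef)
  with has_value_mult[OF 1 2] have "\<exists>c. has_value z (\<Prod>j<d. f j / g j) c"
    by (intro exI) (simp only:)
  then show ?thesis unfolding f_def g_def .
qed

lemma poch_ratio_regular: "\<exists>c. has_value z (poch_ratio qvar (l * d)) c"
proof (induction l)
  case 0
  show ?case by (intro exI[of _ 1]) (simp add: poch_ratio_def)
next
  case (Suc l)
  obtain a where "has_value z (poch_ratio qvar (l * d)) a" using Suc by blast
  moreover obtain b where "has_value z (\<Prod>j<d. (1 - qvar ^ (3 * (l * d + j) + 1)) /
      (1 - qvar ^ (3 * (l * d + j) + 3))) b" using poch_ratio_block_regular by blast
  ultimately have "has_value z (poch_ratio qvar (l * d + d)) (a * b)"
    unfolding poch_ratio_add by (rule has_value_mult)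
  then show ?case by (auto simp: add.commute)
qed

lemma has_value_q_int: "has_value z (q_int qvar m) ((1 - z ^ m) / (1 - z))"
proof -
  have "has_value z (q_int qvar m) (q_int z m)"
    unfolding q_int_def by (intro has_value_intros)
  moreover have "q_int z m = (1 - z ^ m) / (1 - z)"
    using z_neq_1 q_int_mult[of z m] by (simp add: field_simps)
  ultimately show ?thesis by simp
qed

text \<open>At \<open>z\<close> the block equals c^6/(1 - z) times the sum in
  \<open>sum_terms_at_root\<close>, where \<open>c\<close> is the value of
  \<open>poch_ratio qvar (l * d)\<close>: periodicity removes l d from all exponents.\<close>

lemma has_value_block_sum: "has_value z (\<Sum>r<d. summand (l * d + r)) 0"
proof -
  obtain c where c: "has_value z (poch_ratio qvar (l * d)) c" using poch_ratio_regular by blast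
  have "has_value z (\<Sum>r<d. summand (l * d + r))
    (\<Sum>r<d. (1 - z ^ (6 * (l * d + r) + 1)) / (1 - z) * (c * poch_ratio z r) ^ 6 * z ^ (3 * (l * d + r)))"
    unfolding summand_def poch_ratio_add
    by (intro has_value_sum has_value_mult has_value_power has_value_q_int has_value_qvar
        c has_value_shifted_ratio) simp
  also have "(\<Sum>r<d. (1 - z ^ (6 * (l * d + r) + 1)) / (1 - z) * (c * poch_ratio z r) ^ 6 * z ^ (3 * (l * d + r)))
      = (\<Sum>r<d. c ^ 6 / (1 - z) * ((1 - z ^ (6 * r + 1)) * poch_ratio z r ^ 6 * z ^ (3 * r)))"
  proof (intro sum.cong refl)
    fix r
    have "6 * (l * d + r) + 1 = d * (6 * l) + (6 * r + 1)" "3 * (l * d + r) = d * (3 * l) + 3 * r"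
      by simp_all
    then show "(1 - z ^ (6 * (l * d + r) + 1)) / (1 - z) * (c * poch_ratio z r) ^ 6 * z ^ (3 * (l * d + r))
      = c ^ 6 / (1 - z) * ((1 - z ^ (6 * r + 1)) * poch_ratio z r ^ 6 * z ^ (3 * r))"
      by (simp only: power_period power_mult_distrib) (simp add: mult_ac)
  qed
  also have "\<dots> = 0" unfolding sum_distrib_left[symmetric] sum_terms_at_root by simp
  finally show ?thesis .
qed

lemma vanishes_sum_multiple: "vanishes z 1 (\<Sum>k<m * d. summand k)"
proof -
  have "(\<Sum>k = l * d..<l * d + d. summand k) = (\<Sum>r<d. summand (l * d + r))" for l
    by (subst sum.atLeastLessThan_shift_0) (simp add: atLeast0LessThan)
  then have "(\<Sum>k<m * d. summand k) = (\<Sum>l<m. \<Sum>r<d. summand (l * d + r))"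
    by (simp flip: sum.nat_group)
  moreover have "vanishes z 1 \<dots>" by (intro vanishes_sum vanishes_1 has_value_block_sum)
  ultimately show ?thesis by simp
qed

end

text \<open>The identity (1 - y x)(1 - y/x) = (1 - y)^2 - y (1 - x)^2/x, used for \<open>y\<close>
  and for \<open>w\<close>, extracts (1 - x)^2 from the difference. The cofactor \<open>R\<close> is
  regular at \<open>z\<close> because \<open>b\<close> differs from 1.\<close>

lemma vanishes_2_square_diff:
  fixes x y w :: "int poly fract"
  assumes x: "has_value z x 1" and y: "has_value z y a" and w: "has_value z w b" and b: "b \<noteq> 1"
    and nz: "x \<noteq> 0" "w \<noteq> 1" "w * x \<noteq> 1" "w \<noteq> x"
  shows "vanishes z 2 ((1 - y)^2 / (1 - w)^2 - (1 - y * x) * (1 - y / x) / ((1 - w * x) * (1 - w / x)))"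
proof -
  define R where "R = (y * (1 - w)^2 - w * (1 - y)^2) / (x * (1 - w)^2 * ((1 - w * x) * (1 - w / x)))"
  have eq: "(1 - y)^2 / (1 - w)^2 - (1 - y * x) * (1 - y / x) / ((1 - w * x) * (1 - w / x))
    = (1 - x) * (1 - x) * R"
  proof -
    define B where "B = (1 - w * x) * (1 - w / x)"
    have "1 - w / x \<noteq> 0" "1 - w * x \<noteq> 0" "1 - w \<noteq> 0" using nz by (auto simp: field_simps)
    then have B: "B \<noteq> 0" "1 - w \<noteq> 0" by (simp_all add: B_def)
    have Bx: "x * B = (1 - w * x) * (x - w)" using nz by (simp add: B_def field_simps)
    have yx: "1 - y / x = (x - y) / x" using nz by (simp add: field_simps)
    have "(1 - y)^2 * (x * B) - (1 - y * x) * (x - y) * (1 - w)^2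
      = (1 - x) * (1 - x) * (y * (1 - w)^2 - w * (1 - y)^2)"
      unfolding Bx by algebra
    then show ?thesis unfolding R_def B_def[symmetric] yx
      using B nz(1) by (simp add: divide_simps mult_ac)
  qed
  have "has_value z R ((a * (1 - b)^2 - b * (1 - a)^2) / (1 * (1 - b)^2 * ((1 - b * 1) * (1 - b / 1))))"
    unfolding R_def using b by (intro has_value_intros x y w) auto
  moreover have "vanishes z 1 (1 - x)"
    using vanishes_1 has_value_diff[OF has_value_1 x] by simp
  ultimately show ?thesis
    unfolding eq using vanishes_mult_regular vanishes_mult[of z 1 "1 - x" 1 "1 - x"]
    by (metis one_add_one)
qed

text \<open>Congruent regular factors have congruent products: one factor is exchanged at a
  time.\<close>

lemma vanishes_prod_diff:
  assumes "finite A" "\<And>i. i \<in> A \<Longrightarrow> vanishes z m (f i - g i)"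
    and "\<And>i. i \<in> A \<Longrightarrow> has_value z (f i) (a i)" "\<And>i. i \<in> A \<Longrightarrow> has_value z (g i) (b i)"
  shows "vanishes z m (prod f A - prod g A)"
  using assms
proof (induction A rule: finite_induct)
  case (insert i A)
  have "prod f (insert i A) - prod g (insert i A)
      = (f i - g i) * prod f A + (prod f A - prod g A) * g i"
    using insert.hyps by (simp add: algebra_simps)
  also have "vanishes z m \<dots>"
    using insert.prems insert.IH
    by (intro vanishes_add vanishes_mult_regular[OF _ has_value_prod[of A z f a]] vanishes_mult_regular[of _ _ _ "g i" "b i"]) auto
  finally show ?case .
qed simp

section \<open>Vanishing to second order\<close>

lemma qvar_power_eq_iff: "qvar ^ a = qvar ^ b \<longleftrightarrow> a = b"
  by (rule power_eq_power_iff) (auto simp: qvar_nonzero qvar_power_neq_1)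

locale root_of_unity_2_mod_3 = root_of_unity +
  assumes d3: "3 * N + 1 = 2 * d"
begin

text \<open>\<open>poch_ratio qvar k ^ 2\<close> with the two parameters \<open>q\<close> replaced by \<open>q x\<close> and \<open>q / x\<close> for \<open>x = q\<^sup>2\<^sup>d\<close>. The change is
  symmetric in \<open>x\<close> and \<open>1 / x\<close>, hence of order \<open>(1 - x)\<^sup>2\<close>.\<close>

definition deformed_square :: "nat \<Rightarrow> int poly fract" where
  "deformed_square k = (\<Prod>j<k. (1 - qvar ^ (3*j+1) * qvar ^ (2*d)) * (1 - qvar ^ (3*j+1) / qvar ^ (2*d)) /
     ((1 - qvar ^ (3*j+3) * qvar ^ (2*d)) * (1 - qvar ^ (3*j+3) / qvar ^ (2*d))))"

text \<open>Here e = q^(3N+2) = q^(2d+1) = q x, so q^2/e = q/x, q^4/e = q^3/x and q^2 e = q^3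
  x.\<close>

lemma jackson_term_deformed:
  "jackson_term qvar (qvar ^ (3 * N + 2)) k =
     (1 - qvar ^ (6 * k + 1)) * poch_ratio qvar k ^ 4 * deformed_square k * qvar ^ (3 * k)"
proof -
  have e: "qvar ^ (3 * N + 2) = qvar * qvar ^ (2*d)"
    using d3 by (simp flip: power_Suc)
  have "q_pochhammer (qvar * qvar ^ (2*d)) (qvar^3) k * q_pochhammer (qvar^2 / (qvar * qvar ^ (2*d))) (qvar^3) k /
    (q_pochhammer (qvar^4 / (qvar * qvar ^ (2*d))) (qvar^3) k * q_pochhammer (qvar^2 * (qvar * qvar ^ (2*d))) (qvar^3) k)
    = deformed_square k"
  proof -
    have eqs: "qvar^2 / (qvar * qvar ^ (2*d)) = qvar / qvar ^ (2*d)" "qvar^4 / (qvar * qvar ^ (2*d)) = qvar^3 / qvar ^ (2*d)"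
      "qvar^2 * (qvar * qvar ^ (2*d)) = qvar^3 * qvar ^ (2*d)"
      using qvar_nonzero by (simp_all add: power2_eq_square eval_nat_numeral)
    show ?thesis
      unfolding eqs deformed_square_def q_pochhammer_def prod_dividef prod.distrib
      by (simp add: power_add mult_ac flip: power_mult)
  qed
  then show ?thesis
    unfolding jackson_term_def poch_ratio_eq e by simp
qed

lemma has_value_poch_ratio: "k < d \<Longrightarrow> has_value z (poch_ratio qvar k) (poch_ratio z k)"
  using has_value_shifted_ratio[of k 0] by (simp add: poch_ratio_def)

lemma z_power_2d: "z ^ (2 * d) = 1"
  using root by simp

lemma vanishes_square_diff:
  assumes k: "k \<le> N"
  shows "vanishes z 2 (poch_ratio qvar k ^ 2 - deformed_square k)"
proof -
  have sq: "poch_ratio qvar k ^ 2 = (\<Prod>j<k. (1 - qvar ^ (3*j+1))^2 / (1 - qvar ^ (3*j+3))^2)"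
    unfolding poch_ratio_def by (simp add: prod_power_distrib power_divide)
  have x: "has_value z (qvar ^ (2*d)) 1"
    using has_value_power[OF has_value_qvar, of z "2*d"] by (simp add: z_power_2d)
  have v: "has_value z (qvar ^ i) (z ^ i)" for i by (intro has_value_intros)
  have nz: "z ^ (3*j+3) \<noteq> 1" if "j < k" for j
    using denominator_nonzero[of j] that k N by simp
  show ?thesis unfolding sq deformed_square_def
  proof (intro vanishes_prod_diff)
    fix j assume "j \<in> {..<k}"
    then have j: "j < k" by simp
    \<comment> \<open>As 2d = 3N + 1 is not a multiple of 3, the deformed denominator 1 - q^(3j+3)/x
      is not identically zero.\<close>
    have "3*j+3 \<noteq> 2*d" using d3 by presburger
    then show "vanishes z 2 ((1 - qvar ^ (3*j+1))^2 / (1 - qvar ^ (3*j+3))^2 -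
      (1 - qvar ^ (3*j+1) * qvar ^ (2*d)) * (1 - qvar ^ (3*j+1) / qvar ^ (2*d)) /
      ((1 - qvar ^ (3*j+3) * qvar ^ (2*d)) * (1 - qvar ^ (3*j+3) / qvar ^ (2*d))))"
      using qvar_nonzero
      by (intro vanishes_2_square_diff[OF x v v nz[OF j]])
        (simp_all only: power_add[symmetric] qvar_power_eq_iff, simp_all add: qvar_power_neq_1 del: power_Suc)
    show "has_value z ((1 - qvar ^ (3*j+1))^2 / (1 - qvar ^ (3*j+3))^2)
        ((1 - z ^ (3*j+1))^2 / (1 - z ^ (3*j+3))^2)"
      using nz[OF j] by (intro has_value_intros) simp
    show "has_value z ((1 - qvar ^ (3*j+1) * qvar ^ (2*d)) * (1 - qvar ^ (3*j+1) / qvar ^ (2*d)) /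
      ((1 - qvar ^ (3*j+3) * qvar ^ (2*d)) * (1 - qvar ^ (3*j+3) / qvar ^ (2*d))))
      ((1 - z ^ (3*j+1) * 1) * (1 - z ^ (3*j+1) / 1) / ((1 - z ^ (3*j+3) * 1) * (1 - z ^ (3*j+3) / 1)))"
      using nz[OF j] by (intro has_value_intros x) simp_all
  qed simp
qed

lemma vanishes_jackson_sum:
  "vanishes z 2 (\<Sum>k\<le>N. jackson_term qvar (qvar ^ (3 * N + 2)) k)"
proof -
  define \<rho> where "\<rho> j = (1 - qvar ^ (3*j+4)) * (1 - qvar ^ (3*j+2))^3 /
    ((1 - qvar ^ (3*j+3))^3 * (1 - qvar ^ (3*j+1)))" for j
  \<comment> \<open>From 3N + 1 = 2d it follows that j0 = 2N - d satisfies 3 j0 + 2 = d. The cube in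
    the factor at \<open>j0\<close> is (1 - q^d)^3: two of its copies give the order 2, the third
    joins the regular cofactor.\<close>
  define j0 where "j0 = N - (d - N)"
  have j0: "3 * j0 + 2 = d" "j0 < N" using d3 d N by (simp_all add: j0_def)
  have den: "1 - z ^ (3*j+3) \<noteq> 0" "1 - z ^ (3*j+1) \<noteq> 0" if "j < N" for j
    using that N denominator_nonzero[of j] numerator_zero_iff[of j] by auto
  have reg: "has_value z (\<Prod>j\<in>{..<N} - {j0}. \<rho> j) (\<Prod>j\<in>{..<N} - {j0}.
      (1 - z ^ (3*j+4)) * (1 - z ^ (3*j+2))^3 / ((1 - z ^ (3*j+3))^3 * (1 - z ^ (3*j+1))))"
    unfolding \<rho>_def by (intro has_value_intros) (use den in auto)
  have "has_value z (1 - qvar ^ d) (1 - z ^ d)" by (intro has_value_intros)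
  then have "has_value z (1 - qvar ^ d) 0" using root[of d] by simp
  then have "vanishes z (1 + 1) ((1 - qvar ^ d) * (1 - qvar ^ d))"
    by (intro vanishes_mult vanishes_1)
  moreover have "has_value z ((1 - qvar ^ (3*j0+4)) * (1 - qvar ^ d) /
      ((1 - qvar ^ (3*j0+3))^3 * (1 - qvar ^ (3*j0+1))))
    ((1 - z ^ (3*j0+4)) * (1 - z ^ d) / ((1 - z ^ (3*j0+3))^3 * (1 - z ^ (3*j0+1))))"
    by (intro has_value_intros) (use den[OF j0(2)] in auto)
  ultimately have "vanishes z (1 + 1) ((1 - qvar ^ d) * (1 - qvar ^ d) * ((1 - qvar ^ (3*j0+4)) * (1 - qvar ^ d) /
    ((1 - qvar ^ (3*j0+3))^3 * (1 - qvar ^ (3*j0+1)))))"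
    by (rule vanishes_mult_regular)
  moreover have "\<rho> j0 = (1 - qvar ^ d) * (1 - qvar ^ d) * ((1 - qvar ^ (3*j0+4)) * (1 - qvar ^ d) /
    ((1 - qvar ^ (3*j0+3))^3 * (1 - qvar ^ (3*j0+1))))"
    unfolding \<rho>_def j0(1) by (simp add: power3_eq_cube)
  ultimately have "vanishes z 2 (\<rho> j0)" by (simp only: one_add_one)
  moreover have "(\<Prod>j<N. \<rho> j) = \<rho> j0 * (\<Prod>j\<in>{..<N} - {j0}. \<rho> j)"
    using j0 by (intro prod.remove) auto
  ultimately have "vanishes z 2 (\<Prod>j<N. \<rho> j)"
    using vanishes_mult_regular[OF _ reg] by (simp only:)
  moreover have "has_value z (1 - qvar) (1 - z)" by (intro has_value_intros)
  ultimately have "vanishes z 2 ((\<Prod>j<N. \<rho> j) * (1 - qvar))"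
    by (rule vanishes_mult_regular)
  moreover have "(\<Sum>k\<le>N. jackson_term qvar (qvar ^ (3 * N + 2)) k) = (1 - qvar) * (\<Prod>j<N. \<rho> j)"
    unfolding \<rho>_def by (rule jackson_sum) (auto simp: qvar_nonzero qvar_power_neq_1)
  ultimately show ?thesis by (simp only: mult.commute)
qed

text \<open>Multiplication by 1 - q, which is nonzero at \<open>z\<close>, turns the q-integers into
  the factors 1 - q^(6k+1) of the Jackson terms.\<close>

lemma vanishes_2_sum: "vanishes z 2 (\<Sum>k<d. summand k)"
proof -
  let ?J = "jackson_term qvar (qvar ^ (3 * N + 2))"
  have s: "(1 - qvar) * summand k = (1 - qvar ^ (6 * k + 1)) * poch_ratio qvar k ^ 6 * qvar ^ (3 * k)" for k
    unfolding summand_def q_int_mult[symmetric] by simp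
  have low: "vanishes z 2 ((1 - qvar) * summand k - ?J k)" if "k \<in> {..N}" for k
  proof -
    have "(1 - qvar) * summand k - ?J k = (poch_ratio qvar k ^ 2 - deformed_square k) *
      ((1 - qvar ^ (6 * k + 1)) * poch_ratio qvar k ^ 4 * qvar ^ (3 * k))"
      unfolding s jackson_term_deformed by (simp add: algebra_simps flip: power_add)
    moreover have "has_value z ((1 - qvar ^ (6 * k + 1)) * poch_ratio qvar k ^ 4 * qvar ^ (3 * k))
      ((1 - z ^ (6 * k + 1)) * poch_ratio z k ^ 4 * z ^ (3 * k))"
      using that N by (intro has_value_intros has_value_poch_ratio) simp
    ultimately show ?thesis
      using vanishes_mult_regular[OF vanishes_square_diff] that by simp
  qed
  \<comment> \<open>Beyond \<open>N\<close> no comparison is made: \<open>poch_ratio qvar k\<close>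
    vanishes at \<open>z\<close>, so its sixth power has order at least 2.\<close>
  have high: "vanishes z 2 ((1 - qvar) * summand k)" if "k \<in> {..<d} - {..N}" for k
  proof -
    have c: "has_value z (poch_ratio qvar k) (poch_ratio z k)"
      using that by (intro has_value_poch_ratio) simp
    then have "has_value z (poch_ratio qvar k) 0" using that by (simp add: poch_ratio_eq_0)
    then have "vanishes z (1 + 1) (poch_ratio qvar k * poch_ratio qvar k)"
      by (intro vanishes_mult vanishes_1)
    moreover have "has_value z ((1 - qvar ^ (6 * k + 1)) * poch_ratio qvar k ^ 4 * qvar ^ (3 * k))
      ((1 - z ^ (6 * k + 1)) * poch_ratio z k ^ 4 * z ^ (3 * k))"
      by (intro has_value_intros c)
    ultimately have "vanishes z (1 + 1) (poch_ratio qvar k * poch_ratio qvar k *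
        ((1 - qvar ^ (6 * k + 1)) * poch_ratio qvar k ^ 4 * qvar ^ (3 * k)))"
      by (rule vanishes_mult_regular)
    then show ?thesis unfolding s by (simp add: eval_nat_numeral mult_ac)
  qed
  have "{..<d} = {..N} \<union> ({..<d} - {..N})" using N by auto
  then have "(\<Sum>k<d. (1 - qvar) * summand k)
    = (\<Sum>k\<le>N. (1 - qvar) * summand k) + (\<Sum>k\<in>{..<d} - {..N}. (1 - qvar) * summand k)"
    by (metis Diff_disjoint finite_Diff finite_atMost finite_lessThan sum.union_disjoint)
  also have "\<dots> = (\<Sum>k\<le>N. (1 - qvar) * summand k - ?J k) + (\<Sum>k\<le>N. ?J k)
      + (\<Sum>k\<in>{..<d} - {..N}. (1 - qvar) * summand k)"
    by (simp add: sum_subtractf)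
  also have "vanishes z 2 \<dots>"
    by (intro vanishes_add vanishes_jackson_sum vanishes_sum[of "{..N}", OF low] vanishes_sum[OF high])
  finally have "vanishes z 2 ((1 - qvar) * (\<Sum>k<d. summand k))" by (simp add: sum_distrib_left)
  moreover have "has_value z (1 / (1 - qvar)) (1 / (1 - z))"
    using z_neq_1 by (intro has_value_intros) simp
  ultimately have "vanishes z 2 ((1 - qvar) * (\<Sum>k<d. summand k) * (1 / (1 - qvar)))"
    by (rule vanishes_mult_regular)
  then show ?thesis using qvar_power_neq_1[of 1] by simp
qed

end

section \<open>Cyclotomic factors\<close>

lemma cpoly_q_int: "cpoly (q_int [:0, 1:] n) = (\<Sum>i<n. monom 1 i)"
proof (induction n)
  case (Suc n)
  have "[:0, 1:] ^ n = (monom 1 n :: int poly)" by (simp add: monom_altdef)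
  then show ?case using Suc by (simp add: q_int_def cpoly_add map_poly_monom)
qed (simp add: q_int_def)

text \<open>The n - 1 roots of unity other than 1 are roots of [n]; equal degrees and leading
  coefficients force the cofactor to be 1.\<close>

lemma cpoly_q_int_eq_prod:
  assumes "n > 0"
  shows "cpoly (q_int [:0, 1:] n) = (\<Prod>z | z ^ n = 1 \<and> z \<noteq> 1. [:- z, 1:])"
proof -
  let ?A = "{z :: complex. z ^ n = 1 \<and> z \<noteq> 1}" and ?P = "cpoly (q_int [:0, 1:] n)"
  let ?Q = "\<Prod>z\<in>?A. [:- z, 1:]"
  have fin: "finite {z :: complex. z ^ n = 1}" and card: "card {z :: complex. z ^ n = 1} = n"
    using bij_betw_finite[OF bij_betw_roots_unity[OF assms]]
      bij_betw_same_card[OF bij_betw_roots_unity[OF assms]] by simp_all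
  have A: "?A = {z. z ^ n = 1} - {1}" by auto
  have cardA: "card ?A = n - 1" and finA: "finite ?A"
    unfolding A using fin card by (simp_all add: card_Diff_singleton)
  have deg: "degree ?Q = n - 1"
    by (subst degree_prod_eq_sum_degree) (auto simp: cardA)
  have coeff: "coeff ?P i = (if i < n then 1 else 0)" for i
    unfolding cpoly_q_int coeff_sum by (simp add: if_distrib sum.delta)
  have "poly ?P z = 0" if "z \<in> ?A" for z
  proof -
    have "poly ?P z = q_int z n" unfolding cpoly_q_int by (simp add: poly_sum poly_monom q_int_def)
    then show ?thesis using that q_int_mult[of z n] by auto
  qed
  then have "(\<Prod>z\<in>?A. [:- z, 1:] ^ 1) dvd ?P"
    by (intro prod_linear_power_dvd finA) (simp add: poly_eq_0_iff_dvd)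
  then obtain r where r: "?P = ?Q * r" by (auto elim: dvdE)
  have P0: "?P \<noteq> 0" using coeff[of 0] assms by (metis coeff_0 zero_neq_one)
  have degP: "degree ?P = n - 1"
  proof (rule antisym)
    show "degree ?P \<le> n - 1" by (rule degree_le) (use coeff in auto)
    show "n - 1 \<le> degree ?P" using coeff[of "n - 1"] assms by (intro le_degree) simp
  qed
  have "degree r = 0"
    using degree_mult_eq[of ?Q r] P0 degP deg unfolding r by auto
  then obtain c where c: "r = [:c:]" by (metis degree_eq_zeroE)
  have "lead_coeff ?P = 1" using coeff[of "n - 1"] degP assms by simp
  moreover have "lead_coeff ?Q = 1" by (simp add: lead_coeff_prod)
  ultimately have "c = 1" unfolding r c by (simp add: lead_coeff_mult del: mult_pCons_right)
  then show ?thesis using r c by simp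
qed

text \<open>The power depends only on k m modulo \<open>n\<close>, and distinct residues give
  distinct roots of unity.\<close>

lemma primitive_root_power:
  assumes "n > 0" "coprime k n"
  shows "cis (2 * pi * real k / real n) ^ m = 1 \<longleftrightarrow> n dvd m"
proof -
  let ?z = "\<lambda>k::nat. cis (2 * pi * real k / real n)"
  define a r where "a = k * m div n" and "r = k * m mod n"
  have inj: "inj_on ?z {..<n}"
    using bij_betw_roots_unity[OF assms(1)] by (simp add: bij_betw_def)
  have r: "r < n" using assms(1) by (simp add: r_def)
  have "k * m = n * a + r" by (simp add: a_def r_def)
  then have "real m * real k = real n * real a + real r"
    by (metis mult.commute of_nat_add of_nat_mult)
  then have "real m * (2 * pi * real k / real n) = 2 * pi * real a + 2 * pi * real r / real n"
    using assms(1) by (simp add: field_simps) algebra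
  then have "?z k ^ m = cis (2 * pi * real a) * ?z r"
    by (simp only: DeMoivre cis_mult)
  also have "cis (2 * pi * real a) = 1" by (intro cis_multiple_2pi) simp
  finally have "?z k ^ m = 1 \<longleftrightarrow> ?z r = ?z 0" by simp
  also have "\<dots> \<longleftrightarrow> r = 0"
    using inj_onD[OF inj, of r 0] r assms(1) by auto
  also have "\<dots> \<longleftrightarrow> n dvd m"
    using assms(2) by (simp add: r_def mod_eq_0_iff_dvd coprime_dvd_mult_right_iff coprime_commute)
  finally show ?thesis .
qed

lemma cpoly_cyclotomic:
  assumes "n > 1"
  obtains B where "finite B" "cpoly (cyclotomic_poly n) = (\<Prod>z\<in>B. [:- z, 1:])"
    "\<And>z m. z \<in> B \<Longrightarrow> z ^ m = 1 \<longleftrightarrow> n dvd m"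
proof
  let ?z = "\<lambda>k::nat. cis (2 * pi * real k / real n)" and ?K = "{k. k \<in> {1..n} \<and> coprime k n}"
  \<comment> \<open>The indices run over 1..n, the bijection with the roots of unity over 0..n-1;
    for n > 1 coprimality excludes k = n.\<close>
  have "?K \<subseteq> {..<n}"
  proof
    fix k assume "k \<in> ?K"
    then show "k \<in> {..<n}" using assms by (cases "k = n") auto
  qed
  then have "inj_on ?z ?K"
    using bij_betw_roots_unity[of n] assms by (auto simp: bij_betw_def intro: inj_on_subset)
  then have "(\<Prod>z\<in>?z ` ?K. [:- z, 1:]) = (\<Prod>k\<in>?K. [:- ?z k, 1:])"
    by (simp only: prod.reindex o_def)
  then show "cpoly (cyclotomic_poly n) = (\<Prod>z\<in>?z ` ?K. [:- z, 1:])"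
    using cyclotomic_poly_of_int[of n] assms by simp
  show "z ^ m = 1 \<longleftrightarrow> n dvd m" if "z \<in> ?z ` ?K" for z m
    using that primitive_root_power[of n] assms by auto
qed simp

lemma order_root_of_unity:
  fixes z :: complex
  assumes "n > 0" "z ^ n = 1"
  obtains d where "d dvd n" "\<And>m. z ^ m = 1 \<longleftrightarrow> d dvd m"
proof
  define d where "d = (LEAST d. d > 0 \<and> z ^ d = 1)"
  have d: "d > 0" "z ^ d = 1"
    using LeastI[of "\<lambda>d. d > 0 \<and> z ^ d = 1" n] assms by (simp_all add: d_def)
  show iff: "z ^ m = 1 \<longleftrightarrow> d dvd m" for m
  proof
    assume "z ^ m = 1"
    moreover have "z ^ m = (z ^ d) ^ (m div d) * z ^ (m mod d)"
      by (simp flip: power_mult power_add)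
    ultimately have "z ^ (m mod d) = 1" using d by simp
    then have "\<not> 0 < m mod d"
      using not_less_Least[of "m mod d" "\<lambda>d. d > 0 \<and> z ^ d = 1"] d(1) by (auto simp: d_def[symmetric])
    then show "d dvd m" by auto
  qed (use d in \<open>auto simp: power_mult elim!: dvdE\<close>)
  show "d dvd n" using iff assms by blast
qed

text \<open>For d = 3k + 1 take N = k, so 3N + 1 = d; for d = 3k + 2 take N = 2k + 1, so 3N + 1 =
  2d.\<close>

lemma root_of_unity_exists_index:
  fixes d :: nat
  assumes "d > 1" "coprime d 3"
  obtains N where "N < d" "d dvd 3 * N + 1" "d mod 3 = 2 \<longrightarrow> 3 * N + 1 = 2 * d"
proof -
  have "d mod 3 \<noteq> 0"
    using assms by (auto simp: mod_eq_0_iff_dvd coprime_iff_gcd_eq_1 elim!: dvdE)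
  then have "d mod 3 = 1 \<or> d mod 3 = 2" by linarith
  then show thesis
  proof
    assume d1: "d mod 3 = 1"
    have "d = 3 * (d div 3) + d mod 3" by simp
    with d1 assms show thesis by (intro that[of "d div 3"]) auto
  next
    assume d2: "d mod 3 = 2"
    obtain k where k: "d = 3 * k + 2" using d2 by (metis mult_div_mod_eq)
    then have N: "3 * (2 * k + 1) + 1 = 2 * d" by simp
    then have "d dvd 3 * (2 * k + 1) + 1" by (metis dvd_triv_right)
    with k N show thesis by (intro that[of "2 * k + 1"]) auto
  qed
qed

lemma summand_sum_eq:
  "(\<Sum>k = 0..n - 1. q_int qvar (6 * k + 1)
      * (q_pochhammer qvar (qvar ^ 3) k ^ 6 / q_pochhammer (qvar ^ 3) (qvar ^ 3) k ^ 6) * qvar ^ (3 * k))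
    = (\<Sum>k<n. summand k)" if "n > 0"
proof -
  have "{0..n - 1} = {..<n}" using that by auto
  then show ?thesis by (simp only: summand_def power_divide[symmetric] poch_ratio_eq)
qed

theorem theorem2p3:
  fixes n :: nat
  assumes "n > 0" and "coprime n 3"
  shows "let S = (\<Sum>k = 0..n - 1. q_int qvar (6 * k + 1)
                   * (q_pochhammer qvar (qvar ^ 3) k ^ 6 / q_pochhammer (qvar ^ 3) (qvar ^ 3) k ^ 6)
                   * qvar ^ (3 * k))
         in ([n = 1] (mod 3) \<longrightarrow> ratfun_cong S 0 (q_int [:0, 1:] n)) \<and>
            ([n = 2] (mod 3) \<longrightarrow> ratfun_cong S 0 (q_int [:0, 1:] n * cyclotomic_poly n))"
proof -
  define S where "S = (\<Sum>k<n. summand k)"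
  let ?F = "cpoly (fst (quot_of_fract S))" and ?A = "{z :: complex. z ^ n = 1 \<and> z \<noteq> 1}"
  let ?I = "q_int [:0, 1:] n :: int poly"
  have finA: "finite ?A"
  proof (rule finite_subset)
    show "finite {z :: complex. z ^ n = 1}" using bij_betw_finite[OF bij_betw_roots_unity[OF assms(1)]] by simp
  qed auto
  have simple: "[:- z, 1:] dvd ?F" if z: "z \<in> ?A" for z
  proof -
    obtain d where ord: "d dvd n" "\<And>m. z ^ m = 1 \<longleftrightarrow> d dvd m"
      using order_root_of_unity[of n z] assms z by blast
    have "d \<noteq> 0" "d \<noteq> 1" using ord(1) ord(2)[of 1] assms(1) z by auto
    moreover have "coprime d 3" using ord(1) assms(2) by (meson coprime_divisors dvd_refl)
    ultimately obtain N where idx: "N < d" "d dvd 3 * N + 1" "d > 1" "coprime d 3"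
      using root_of_unity_exists_index[of d] by (metis less_one linorder_neqE_nat)
    have "root_of_unity z d N" using ord(2) idx by unfold_locales
    then have "vanishes z 1 (\<Sum>k<n div d * d. summand k)" by (rule root_of_unity.vanishes_sum_multiple)
    then have "vanishes z 1 S" using ord(1) by (simp only: S_def dvd_div_mult_self)
    from vanishes_numerator[OF this] show ?thesis by (simp only: power_one_right)
  qed
  have monicI: "lead_coeff ?I = 1"
  proof -
    have "lead_coeff (cpoly ?I) = 1"
      unfolding cpoly_q_int_eq_prod[OF assms(1)] by (simp add: lead_coeff_prod)
    then show ?thesis by (simp add: degree_cpoly coeff_map_poly)
  qed
  have 1: "?I dvd fst (quot_of_fract S)"
  proof (rule cpoly_dvd_monic[OF monicI])
    show "cpoly ?I dvd ?F"
      unfolding cpoly_q_int_eq_prod[OF assms(1)]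
      using prod_linear_power_dvd[OF finA, of "\<lambda>_. 1" ?F] simple by simp
  qed
  have 2: "?I * cyclotomic_poly n dvd fst (quot_of_fract S)" if n2: "n mod 3 = 2"
  proof -
    have "n > 1" using n2 by (cases "n = 1") (use assms in auto)
    then obtain B where B: "finite B" "cpoly (cyclotomic_poly n) = (\<Prod>z\<in>B. [:- z, 1:])"
      "\<And>z m. z \<in> B \<Longrightarrow> z ^ m = 1 \<longleftrightarrow> n dvd m"
      using cpoly_cyclotomic by blast
    have BA: "B \<subseteq> ?A"
    proof
      fix z assume "z \<in> B"
      then show "z \<in> ?A" using B(3)[of z n] B(3)[of z 1] \<open>n > 1\<close> by auto
    qed
    \<comment> \<open>Primitive n-th roots count twice: once as roots of [n] and once as roots of
      the cyclotomic polynomial.\<close>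
    define mu :: "complex \<Rightarrow> nat" where "mu z = (if z \<in> B then 2 else 1)" for z
    have double: "[:- z, 1:] ^ 2 dvd ?F" if z: "z \<in> B" for z
    proof -
      obtain N where idx: "N < n" "n dvd 3 * N + 1" "3 * N + 1 = 2 * n"
        using root_of_unity_exists_index[of n] \<open>n > 1\<close> assms(2) n2 by blast
      have "root_of_unity_2_mod_3 z n N"
        using B(3)[OF z] idx \<open>n > 1\<close> assms(2) by unfold_locales
      then have "vanishes z 2 S" unfolding S_def by (rule root_of_unity_2_mod_3.vanishes_2_sum)
      then show ?thesis by (rule vanishes_numerator)
    qed
    have "cpoly (?I * cyclotomic_poly n) = (\<Prod>z\<in>?A. [:- z, 1:]) * (\<Prod>z\<in>B. [:- z, 1:])"
      by (simp add: cpoly_mult cpoly_q_int_eq_prod[OF assms(1)] B(2))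
    also have "(\<Prod>z\<in>B. [:- z, 1:]) = (\<Prod>z\<in>?A. if z \<in> B then [:- z, 1:] else 1)"
      using BA finA by (simp add: prod.If_cases Int_absorb1)
    also have "(\<Prod>z\<in>?A. [:- z, 1:]) * \<dots> = (\<Prod>z\<in>?A. [:- z, 1:] ^ mu z)"
      unfolding prod.distrib[symmetric] by (intro prod.cong) (auto simp: mu_def power2_eq_square)
    finally have eq: "cpoly (?I * cyclotomic_poly n) = (\<Prod>z\<in>?A. [:- z, 1:] ^ mu z)" .
    have "lead_coeff (cpoly (?I * cyclotomic_poly n)) = 1"
      unfolding eq by (simp add: lead_coeff_prod lead_coeff_power)
    then have "lead_coeff (?I * cyclotomic_poly n) = 1" by (simp add: degree_cpoly coeff_map_poly)
    then show ?thesis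
    proof (rule cpoly_dvd_monic)
      show "cpoly (?I * cyclotomic_poly n) dvd ?F"
        unfolding eq using simple double by (intro prod_linear_power_dvd finA) (simp add: mu_def)
    qed
  qed
  show ?thesis
    unfolding Let_def summand_sum_eq[OF assms(1)] S_def[symmetric] ratfun_cong_def
    using 1 2 by (auto simp: cong_def)
qed

end
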